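(* Let $0<m\le M<\infty$, let $(q,V,\Gamma)\in PC_{\delta,m,M,ap}(\mathbb{R})$ be real-valued (i.e. $q$ and $V$ are real-valued), with $\Gamma=\{x_n\}_{n\in\mathbb{Z}}$, and let $E\in\mathbb{R}$. For any $\Xi\in\mathbb{R}$, the limit $$\lim_{n\to+\infty}\frac{\theta_E\bigl(x_n;(q,V,\Gamma),\Xi\bigr)-\Xi}{x_n}$$ exists and is independent of the choice of $\Xi\in\mathbb{R}$. Thus the rotation number $$\rho(E):=\lim_{x\to+\infty}\frac{\theta_E\bigl(x;(q,V,\Gamma),\Xi\bigr)-\Xi}{x}$$ is well defined.
   Context: $\mathbb{K}$ is $\mathbb{R}$ or $\mathbb{C}$, $\mathbb{N}_0=\{0,1,2,\dots\}$. **Point sets.** For $0<m\le M<\infty$, $L_{m,M}(\mathbb{Z})$ is the set of all $\Gamma=\{x_i\}_{i\in\mathbb{Z}}\subset\mathbb{R}$ with $x_0=0$ and $x_i-x_{i-1}\in[m,M]$ for all $i$, with metric $\mathrm{dist}(\Gamma_1,\Gamma_2)=\max\{\sup_i\min_j|x_i^1-x_j^2|,\ \sup_i\min_j|x_i^2-x_j^1|\}$ for $\Gamma_k=\{x_i^k\}$. For $\tau\in\mathbb{Z}$, $\Gamma\cdot\tau:=\{x_{i+\tau}-x_\tau\}_{i\in\mathbb{Z}}$. For a bounded bi-sequence $V=\{v_i\}_{i\in\mathbb{Z}}\in\ell^\infty(\mathbb{Z})$, $V\cdot\tau:=\{v_{i+\tau}\}_{i\in\mathbb{Z}}$. **Functions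 with jumps and $\delta$-interactions.** $PC_{u,\delta,m,M}(\mathbb{R})$ is the set of triples $(f,V,\Gamma)$ with $\Gamma\in L_{m,M}(\mathbb{Z})$, $V\in\ell^\infty(\mathbb{Z})$, and $f:\mathbb{R}\setminus\Gamma\to\mathbb{K}$ bounded and such that for every $\varepsilon>0$ there is $\delta>0$ with $|f(x)-f(y)|<\varepsilon$ whenever $|x-y|<\delta$ and $x,y$ lie in the same component interval of $\mathbb{R}\setminus\Gamma$. The triple represents $f(x)+\sum_i v_i\delta(x-x_i)$. For $A\subset\mathbb{R}$, $F_r(A)=\{x:|x-y|\le r\text{ for some }y\in A\}$. Let $S_r$ ($r>0$) be the set of pairs $((f_1,V_1,\Gamma_1),(f_2,V_2,\Gamma_2))$ with $\mathrm{dist}(\Gamma_1,\Gamma_2)<r$, $\|V_1-V_2\|_\infty<r$ and $|f_1(x)-f_2(x)|<r$ for all $x\in\mathbb{R}\setminus F_r(\Gamma_1\cup\Gamma_2)$; let $U_0$ be the set of all pairs and $U_n=S_{4^{-n}}$ for $n\ge1$. The family $\{U_n\}_{n\in\mathbb{N}_0}$ is a base of a metrizable uniformity; $\mathrm{dist}$ denotes a fixed metric on $PC_{u,\delta,m,M}(\mathbb{R})$ inducing it, with $U_n\subset\{\mathrm{dist}<2^{-n}\}\subset U_{n-1}$ for all $n\ge1$. The shift is $(f,V,\Gamma)\cdot\tau:=(f(\cdot+x_\tau),V\cdot\tau,\Gamma\cdot\tau)$, $\tau\in\mathbb{Z}$, and the hull $\mathrm{H}((f,V,\Gamma))$ is the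 closure of $\{(f,V,\Gamma)\cdot\tau:\tau\in\mathbb{Z}\}$ in $(PC_{u,\delta,m,M}(\mathbb{R}),\mathrm{dist})$. $PC_{\delta,m,M,ap}(\mathbb{R})$ is the set of $(f,V,\Gamma)$ that are almost periodic, i.e. whose hull is compact (equivalently, every sequence of shifts has a convergent subsequence). **Angle function.** For $c,\Xi\in\mathbb{R}$, $\tau\in[0,1]$ let $F(c,\tau,\Xi)$ be the continuous branch of $\arg(\cos\Xi+\tau c\sin\Xi+\mathrm{i}\sin\Xi)$ with $F(c,0,\Xi)=\Xi$, and set $J(c,\Xi):=F(c,1,\Xi)-F(c,0,\Xi)$. For real-valued $(\tilde q,\tilde V,\tilde\Gamma)\in PC_{u,\delta,m,M}(\mathbb{R})$ with $\tilde\Gamma=\{\tilde x_n\}$, $\tilde V=\{\tilde v_n\}$, and $E,\Xi\in\mathbb{R}$, $\theta_E(x)=\theta_E(x;(\tilde q,\tilde V,\tilde\Gamma),\Xi)$, $x\in\mathbb{R}$, is the right-continuous solution with $\theta_E(0)=\Xi$ of $\theta'(x)=\cos^2\theta(x)-(\tilde q(x)-E)\sin^2\theta(x)$ for $x\in\mathbb{R}\setminus\tilde\Gamma$, $\theta(\tilde x_n+)-\theta(\tilde x_n-)=J(\tilde v_n,\theta(\tilde x_n-))$ for $\tilde x_n\in\tilde\Gamma$. It is the Prüfer angle $\arg(\psi'+\mathrm{i}\psi)$ of solutions of $-\psi''+(\tilde q+\sum_n\tilde v_n\delta(\cdot-\tilde x_n))\psi=E\psi$. *)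

theory Defs
  imports "HOL-Analysis.Analysis"
begin

section \<open>Functions with jumps and delta interactions\<close>

text \<open>A point set \<open>\<Gamma> = {x\<^sub>i}\<close> is given by its enumeration \<open>X :: int \<Rightarrow> real\<close>. The
  normalisation \<open>X 0 = 0\<close> and the positive gaps make the enumeration unique.\<close>

definition point_sets :: "real \<Rightarrow> real \<Rightarrow> (int \<Rightarrow> real) set" where
  "point_sets m M = {X. X 0 = 0 \<and> (\<forall>i. X i - X (i - 1) \<in> {m..M})}"

text \<open>The infima below are attained and the suprema are finite on \<^term>\<open>point_sets m M\<close>.\<close>

definition point_dist :: "(int \<Rightarrow> real) \<Rightarrow> (int \<Rightarrow> real) \<Rightarrow> real" where
  "point_dist X Y =
     max (SUP i. INF j. \<bar>X i - Y j\<bar>) (SUP i. INF j. \<bar>Y i - X j\<bar>)"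

type_synonym 'k triple = "(real \<Rightarrow> 'k) \<times> (int \<Rightarrow> 'k) \<times> (int \<Rightarrow> real)"

text \<open>The scalar field \<open>\<real>\<close> or \<open>\<complex>\<close> is a type of class \<^class>\<open>real_normed_field\<close>; by Ostrowski's
  theorem these two are, up to isometric isomorphism, the only instances. A function on
  \<open>\<real> - \<Gamma>\<close> is represented by its extension by \<open>0\<close> to \<open>\<Gamma>\<close>, so that equality of triples is
  equality of functions on \<open>\<real> - \<Gamma>\<close>.\<close>

definition PC :: "real \<Rightarrow> real \<Rightarrow> 'k::real_normed_field triple set" where
  "PC m M = {(f, V, X). X \<in> point_sets m M \<and> bounded (range V) \<and>
     (\<forall>x\<in>range X. f x = 0) \<and> bounded (f ` (- range X)) \<and>
     (\<forall>\<epsilon>>0. \<exists>\<delta>>0. \<forall>x y. \<bar>x - y\<bar> < \<delta> \<and> connected_component (- range X) x y \<longrightarrow>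
        norm (f x - f y) < \<epsilon>)}"

definition fattening :: "real \<Rightarrow> real set \<Rightarrow> real set" where
  "fattening r A = {x. \<exists>y\<in>A. \<bar>x - y\<bar> \<le> r}"

definition entourage_S ::
    "real \<Rightarrow> real \<Rightarrow> real \<Rightarrow> ('k::real_normed_field triple \<times> 'k triple) set" where
  "entourage_S m M r = {((f1, V1, X1), (f2, V2, X2)).
     (f1, V1, X1) \<in> PC m M \<and> (f2, V2, X2) \<in> PC m M \<and>
     point_dist X1 X2 < r \<and> (SUP i. norm (V1 i - V2 i)) < r \<and>
     (\<forall>x. x \<notin> fattening r (range X1 \<union> range X2) \<longrightarrow> norm (f1 x - f2 x) < r)}"

definition entourage_U ::
    "real \<Rightarrow> real \<Rightarrow> nat \<Rightarrow> ('k::real_normed_field triple \<times> 'k triple) set" where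
  "entourage_U m M n = (if n = 0 then PC m M \<times> PC m M else entourage_S m M (1 / 4 ^ n))"

text \<open>The metrics that are admissible as the fixed metric on \<^term>\<open>PC m M\<close>. The two inclusions
  say in particular that \<open>d\<close> induces the uniformity with base \<^term>\<open>entourage_U m M\<close>. For
  \<open>0 < m\<close> such metrics exist: \<open>d p p' = sqrt (Inf {r > 0. (p, p') \<in> entourage_S m M r}) / 2\<close> is
  one.\<close>

definition PC_metric ::
    "real \<Rightarrow> real \<Rightarrow> ('k::real_normed_field triple \<Rightarrow> 'k triple \<Rightarrow> real) \<Rightarrow> bool" where
  "PC_metric m M d \<longleftrightarrow> Metric_space (PC m M) d \<and>
     (\<forall>n\<ge>1. entourage_U m M n \<subseteq> {(p, p') \<in> PC m M \<times> PC m M. d p p' < 1 / 2 ^ n} \<and>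
            {(p, p') \<in> PC m M \<times> PC m M. d p p' < 1 / 2 ^ n} \<subseteq> entourage_U m M (n - 1))"

fun shift :: "'k triple \<Rightarrow> int \<Rightarrow> 'k triple" where
  "shift (f, V, X) \<tau> = ((\<lambda>x. f (x + X \<tau>)), (\<lambda>i. V (i + \<tau>)), (\<lambda>i. X (i + \<tau>) - X \<tau>))"

definition shift_hull :: "real \<Rightarrow> real \<Rightarrow> ('k::real_normed_field triple \<Rightarrow> 'k triple \<Rightarrow> real) \<Rightarrow>
    'k triple \<Rightarrow> 'k triple set" where
  "shift_hull m M d p = Metric_space.mtopology (PC m M) d closure_of range (shift p)"

definition PC_ap :: "real \<Rightarrow> real \<Rightarrow> ('k::real_normed_field triple \<Rightarrow> 'k triple \<Rightarrow> real) \<Rightarrow>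
    'k triple set" where
  "PC_ap m M d =
     {p \<in> PC m M. compactin (Metric_space.mtopology (PC m M) d) (shift_hull m M d p)}"


section \<open>The angle function\<close>

text \<open>\<open>branch c \<Xi> \<phi>\<close>: \<open>\<phi>\<close> is a continuous branch on \<open>[0,1]\<close> of the argument of the (nowhere
  vanishing) path \<open>\<tau> \<mapsto> cos \<Xi> + \<tau> c sin \<Xi> + i sin \<Xi>\<close>, starting at \<open>\<Xi>\<close>.\<close>

definition branch :: "real \<Rightarrow> real \<Rightarrow> (real \<Rightarrow> real) \<Rightarrow> bool" where
  "branch c \<Xi> \<phi> \<longleftrightarrow> continuous_on {0..1} \<phi> \<and> \<phi> 0 = \<Xi> \<and>
     (\<forall>\<tau>\<in>{0..1}. let z = Complex (cos \<Xi> + \<tau> * c * sin \<Xi>) (sin \<Xi>)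
        in z = of_real (cmod z) * cis (\<phi> \<tau>))"

definition angle_F :: "real \<Rightarrow> real \<Rightarrow> real \<Rightarrow> real" where
  "angle_F c \<tau> \<Xi> = (THE y. \<exists>\<phi>. branch c \<Xi> \<phi> \<and> \<phi> \<tau> = y)"

definition angle_J :: "real \<Rightarrow> real \<Rightarrow> real" where
  "angle_J c \<Xi> = angle_F c 1 \<Xi> - angle_F c 0 \<Xi>"

text \<open>In the jump condition \<open>l\<close> is the left limit of \<open>\<theta>\<close> at \<open>X n\<close>; the right limit is
  \<open>\<theta> (X n)\<close> by right continuity.\<close>

fun prufer_solution :: "real \<Rightarrow> real triple \<Rightarrow> real \<Rightarrow> (real \<Rightarrow> real) \<Rightarrow> bool" where
  "prufer_solution E (q, V, X) \<Xi> \<theta> \<longleftrightarrow>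
     \<theta> 0 = \<Xi> \<and> (\<forall>x. continuous (at_right x) \<theta>) \<and>
     (\<forall>x. x \<notin> range X \<longrightarrow>
        (\<theta> has_real_derivative (cos (\<theta> x))\<^sup>2 - (q x - E) * (sin (\<theta> x))\<^sup>2) (at x)) \<and>
     (\<forall>n. \<exists>l. (\<theta> \<longlongrightarrow> l) (at_left (X n)) \<and> \<theta> (X n) - l = angle_J (V n) l)"

definition prufer_angle :: "real \<Rightarrow> real triple \<Rightarrow> real \<Rightarrow> real \<Rightarrow> real" where
  "prufer_angle E p \<Xi> = (THE \<theta>. prufer_solution E p \<Xi> \<theta>)"

end

theory Submission
  imports Defs
begin

text \<open>
Follow the angle from one point of \<open>\<Gamma>\<close> to the next. On a segment the angle solves a Lipschitz
equation; the jump at the end of the segment is again the time-one map of such an equation, because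
the continuous branch \<open>F(c, \<tau>, \<Xi>)\<close> satisfies \<open>\<partial>F/\<partial>\<tau> = - c sin\<^sup>2 F\<close>. After each segment is rescaled
to unit length, both equations have the form \<open>y' = a cos\<^sup>2 y - b(t) sin\<^sup>2 y\<close>, whose time-one map is an
increasing homeomorphism of the line that commutes with the translation by \<open>\<pi>\<close>, is Lipschitz, and
depends continuously on \<open>a\<close> and \<open>b\<close>. So \<open>\<theta>(x\<^sub>n)\<close> is an orbit of a sequence of such lifts of circle
homeomorphisms.

Let \<open>D(s, N)\<close> be the displacement of \<open>0\<close> under the \<open>N\<close> lifts that start with number \<open>s\<close>. Monotonicity
and periodicity make the displacement of any two starting angles differ by at most \<open>\<pi>\<close>; this yields
independence of \<open>\<Xi>\<close> and makes \<open>D\<close> additive along an orbit up to a bounded error. Almost periodicity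
supplies, for each block length \<open>k\<close>, finitely many times \<open>t\<close> such that every tail of the sequence of
lifts is so close to one of the tails starting at \<open>t\<close> that \<open>k\<close> consecutive steps differ by at most
\<open>1\<close>. Cutting \<open>N\<close> steps into blocks of length \<open>k\<close> then gives \<open>\<bar>D(s, N) - D(0, N)\<bar> \<le> 9 N / k + A\<^sub>k\<close> for
all \<open>s\<close>. With this, \<open>D(0, n N)\<close> is close to \<open>n D(0, N)\<close>, and \<open>D(0, N) / N\<close> is a Cauchy sequence
(\<open>drift_rate_Cauchy\<close>). The same result for the lifts \<open>x \<mapsto> x + (x\<^sub>n\<^sub>+\<^sub>1 - x\<^sub>n)\<close> shows that \<open>x\<^sub>N / N\<close> converges, to a
limit at least \<open>m\<close>, and the quotient of the two limits is the rotation number.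

Compactness of the hull enters only as total boundedness of the shifts (\<open>shifts_totally_bounded\<close>).
The metric compares whole triples, so closeness of two shifts is closeness of all later
segments at once. Since the gaps are at least \<open>m\<close>, two point sets at small distance match point by point
(\<open>enumerations_close\<close>), and the uniform modulus of continuity of \<open>q\<close> controls the parts of a segment
near its ends, where the uniformity says nothing (\<open>segments_close\<close>).
\<close>

section \<open>Global solutions of Lipschitz scalar equations\<close>

text \<open>Only the values of the derivative in the open interval are used, so that the lemma applies to angles on
a segment between two jumps. The proof replaces \<open>\<bar>u\<bar>\<close> by the smooth majorant \<open>sqrt (u\<^sup>2 + \<delta>\<^sup>2)\<close>.\<close>

lemma gronwall:
  fixes u u' :: "real \<Rightarrow> real"
  assumes T: "0 \<le> T" and "0 \<le> K" "0 \<le> \<eta>"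
    and cont: "continuous_on {0..T} u"
    and deriv: "\<And>t. 0 < t \<Longrightarrow> t < T \<Longrightarrow> (u has_real_derivative u' t) (at t)"
    and bound: "\<And>t. 0 < t \<Longrightarrow> t < T \<Longrightarrow> \<bar>u' t\<bar> \<le> K * \<bar>u t\<bar> + \<eta>"
  shows "\<bar>u T\<bar> \<le> (\<bar>u 0\<bar> + \<eta> * T) * exp (K * T)"
proof (rule field_le_epsilon)
  fix e :: real
  assume "0 < e"
  define \<delta> where "\<delta> = e / exp (K * T)"
  have \<delta>: "0 < \<delta>" using \<open>0 < e\<close> by (simp add: \<delta>_def)
  define w where "w t = sqrt ((u t)\<^sup>2 + \<delta>\<^sup>2)" for t
  have pos: "0 < (u t)\<^sup>2 + \<delta>\<^sup>2" for t using \<delta> by (simp add: add_nonneg_pos)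
  have w: "0 < w t" "\<bar>u t\<bar> \<le> w t" for t
  proof -
    show "0 < w t" using pos by (simp add: w_def)
    have "\<bar>u t\<bar> = sqrt ((u t)\<^sup>2)" by simp
    also have "\<dots> \<le> w t" unfolding w_def by (intro real_sqrt_le_mono) simp
    finally show "\<bar>u t\<bar> \<le> w t" .
  qed
  define g where "g t = w t * exp (- K * t) - \<eta> * t" for t
  have contw: "continuous_on {0..T} g"
    unfolding g_def w_def by (intro continuous_intros cont)
  have "g T \<le> g 0"
  proof (rule DERIV_nonpos_imp_decreasing_open[OF T _ contw])
    fix t assume t: "0 < t" "t < T"
    let ?w' = "u t * u' t / w t"
    have dw: "(w has_real_derivative ?w') (at t)"
      unfolding w_def
      using pos[of t]
      by (auto intro!: derivative_eq_intros deriv[OF t] simp: divide_simps)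
    have dg: "(g has_real_derivative (?w' - K * w t) * exp (- K * t) - \<eta>) (at t)"
      unfolding g_def by (auto intro!: derivative_eq_intros dw simp: algebra_simps)
    have "?w' \<le> \<bar>u t\<bar> * \<bar>u' t\<bar> / w t"
      using w(1)[of t] by (intro divide_right_mono) (simp_all flip: abs_mult)
    also have "\<dots> \<le> \<bar>u' t\<bar>"
      using w[of t] by (simp add: divide_simps mult_mono mult.commute)
    also have "\<dots> \<le> K * w t + \<eta>"
      using bound[OF t] mult_left_mono[OF w(2) \<open>0 \<le> K\<close>, of t] by linarith
    finally have "(?w' - K * w t) * exp (- K * t) \<le> \<eta> * exp (- K * t)"
      by (intro mult_right_mono) auto
    also have "\<dots> \<le> \<eta>"
      using t \<open>0 \<le> K\<close> \<open>0 \<le> \<eta>\<close> by (intro mult_left_le) auto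
    finally show "\<exists>y. (g has_real_derivative y) (at t) \<and> y \<le> 0"
      using dg by auto
  qed
  moreover have "w 0 \<le> \<bar>u 0\<bar> + \<delta>"
    unfolding w_def using sqrt_sum_squares_le_sum_abs[of "u 0" \<delta>] \<delta> by simp
  ultimately have "w T * exp (- K * T) \<le> \<bar>u 0\<bar> + \<delta> + \<eta> * T"
    by (simp add: g_def)
  hence "w T \<le> (\<bar>u 0\<bar> + \<delta> + \<eta> * T) * exp (K * T)"
    by (simp add: exp_minus field_simps)
  also have "\<dots> = (\<bar>u 0\<bar> + \<eta> * T) * exp (K * T) + e"
    by (simp add: \<delta>_def algebra_simps)
  finally show "\<bar>u T\<bar> \<le> (\<bar>u 0\<bar> + \<eta> * T) * exp (K * T) + e"
    using w(2)[of T] by linarith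
qed

text \<open>Backward in time the assertion follows by reflection at \<open>t\<^sub>0\<close>.\<close>

lemma gronwall_zero:
  fixes u u' :: "real \<Rightarrow> real"
  assumes "0 \<le> K"
    and deriv: "\<And>t. (u has_real_derivative u' t) (at t)"
    and bound: "\<And>t. \<bar>u' t\<bar> \<le> K * \<bar>u t\<bar>"
    and zero: "u t0 = 0"
  shows "u t = 0"
proof -
  have cont: "continuous_on S u" for S
    using deriv by (meson DERIV_isCont continuous_at_imp_continuous_on)
  show ?thesis
  proof (cases "t0 \<le> t")
    case True
    have "\<bar>u (t0 + (t - t0))\<bar> \<le> (\<bar>u (t0 + 0)\<bar> + 0 * (t - t0)) * exp (K * (t - t0))"
    proof (rule gronwall[where u' = "\<lambda>s. u' (t0 + s)"])
      show "continuous_on {0..t - t0} (\<lambda>s. u (t0 + s))"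
        by (intro continuous_on_compose2[OF cont[of UNIV]] continuous_intros) auto
      show "((\<lambda>s. u (t0 + s)) has_real_derivative u' (t0 + s)) (at s)" for s
        by (rule DERIV_chain2[OF deriv, where Db = 1, simplified])
           (auto intro!: derivative_eq_intros)
    qed (use assms True in auto)
    thus ?thesis using zero by simp
  next
    case False
    have "\<bar>u (t0 - (t0 - t))\<bar> \<le> (\<bar>u (t0 - 0)\<bar> + 0 * (t0 - t)) * exp (K * (t0 - t))"
    proof (rule gronwall[where u' = "\<lambda>s. - u' (t0 - s)"])
      show "continuous_on {0..t0 - t} (\<lambda>s. u (t0 - s))"
        by (intro continuous_on_compose2[OF cont[of UNIV]] continuous_intros) auto
      show "((\<lambda>s. u (t0 - s)) has_real_derivative - u' (t0 - s)) (at s)" for s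
        by (rule DERIV_chain2[OF deriv, where Db = "-1", simplified])
           (auto intro!: derivative_eq_intros)
    qed (use assms False in auto)
    thus ?thesis using zero by simp
  qed
qed

text \<open>The gain of the factor \<open>1/2\<close> under the weight \<open>exp (2 K \<bar>t\<bar>)\<close>, which makes the Picard operator below
a contraction on the whole line.\<close>

lemma exp_weighted_bound:
  fixes g g' :: "real \<Rightarrow> real"
  assumes "0 < K" "0 \<le> D"
    and deriv: "\<And>t. (g has_real_derivative g' t) (at t)"
    and bound: "\<And>t. \<bar>g' t\<bar> \<le> K * D * exp (2 * K * \<bar>t\<bar>)"
    and zero: "g 0 = 0"
  shows "\<bar>g t\<bar> \<le> D / 2 * exp (2 * K * \<bar>t\<bar>)"
proof -
  have half_line: "h t \<le> D / 2 * exp (2 * K * t)"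
    if "0 \<le> t" "h 0 = 0" and dh: "\<And>s. (h has_real_derivative h' s) (at s)"
      and bh: "\<And>s. 0 \<le> s \<Longrightarrow> h' s \<le> K * D * exp (2 * K * s)"
    for h h' :: "real \<Rightarrow> real" and t
  proof -
    define H where "H s = D / 2 * exp (2 * K * s) - h s" for s
    have "H 0 \<le> H t"
    proof (rule DERIV_nonneg_imp_nondecreasing[OF \<open>0 \<le> t\<close>])
      fix s assume "0 \<le> s" "s \<le> t"
      have "(H has_real_derivative K * D * exp (2 * K * s) - h' s) (at s)"
        unfolding H_def by (auto intro!: derivative_eq_intros dh)
      thus "\<exists>y. (H has_real_derivative y) (at s) \<and> 0 \<le> y"
        using bh[OF \<open>0 \<le> s\<close>] by force
    qed
    thus ?thesis using that(2) \<open>0 \<le> D\<close> by (simp add: H_def)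
  qed
  have ub: "g' s \<le> K * D * exp (2 * K * s)" "- g' s \<le> K * D * exp (2 * K * s)" if "0 \<le> s" for s
    using bound[of s] that by auto
  have ub': "g' (- s) \<le> K * D * exp (2 * K * s)" "- g' (- s) \<le> K * D * exp (2 * K * s)"
    if "0 \<le> s" for s
    using bound[of "- s"] that by auto
  have refl: "((\<lambda>s. g (- s)) has_real_derivative - g' (- s)) (at s)" for s
    by (rule DERIV_chain2[OF deriv, where Db = "-1", simplified])
       (auto intro!: derivative_eq_intros)
  show ?thesis
  proof (cases "0 \<le> t")
    case True
    show ?thesis
      using half_line[of t g g', OF True zero deriv ub(1)]
        half_line[of t "\<lambda>s. - g s" "\<lambda>s. - g' s", OF True _ DERIV_minus[OF deriv] ub(2)]
        zero True by auto
  next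
    case False
    hence t: "0 \<le> - t" by simp
    show ?thesis
      using half_line[of "- t" "\<lambda>s. g (- s)" "\<lambda>s. - g' (- s)", OF t _ refl ub'(2)]
        half_line[of "- t" "\<lambda>s. - g (- s)" "\<lambda>s. g' (- s)", OF t _ _ ub'(1)]
        DERIV_minus[OF refl] zero False by auto
  qed
qed

lemma antiderivative_exists:
  fixes h :: "real \<Rightarrow> real"
  assumes "continuous_on UNIV h"
  obtains H where "H 0 = 0" "\<And>t. (H has_real_derivative h t) (at t)"
proof -
  have "\<exists>F. \<forall>x. -\<infinity> < ereal x \<longrightarrow> ereal x < \<infinity> \<longrightarrow> (F has_vector_derivative h x) (at x)"
    by (rule einterval_antiderivative)
       (use assms in \<open>auto simp: continuous_on_eq_continuous_at\<close>)
  then obtain F where F: "\<And>x. (F has_real_derivative h x) (at x)"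
    by (auto simp: has_real_derivative_iff_has_vector_derivative)
  show ?thesis
    by (rule that[of "\<lambda>x. F x - F 0"]) (auto intro!: derivative_eq_intros F)
qed

text \<open>Picard iteration in Bielecki's weighted norm: with \<open>y(t\<^sub>0 + t) = y\<^sub>0 + exp (2 L \<bar>t\<bar>) z(t)\<close> the integral
equation becomes a fixed point equation for \<open>z\<close> in the bounded continuous functions on \<open>\<real>\<close>, where the
operator is a contraction with factor \<open>1/2\<close>. One fixed point yields a solution on the whole line.\<close>

lemma lipschitz_ode_exists:
  fixes f :: "real \<Rightarrow> real \<Rightarrow> real"
  assumes cont: "continuous_on UNIV (\<lambda>(t, y). f t y)"
    and bnd: "\<And>t y. \<bar>f t y\<bar> \<le> B"
    and lip: "\<And>t y z. \<bar>f t y - f t z\<bar> \<le> K * \<bar>y - z\<bar>"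
  shows "\<exists>y. y t0 = y0 \<and> (\<forall>t. (y has_real_derivative f t (y t)) (at t))"
proof -
  define L where "L = max K 1"
  have L: "0 < L" by (simp add: L_def)
  have lipL: "\<bar>f t y - f t z\<bar> \<le> L * \<bar>y - z\<bar>" for t y z
    using lip[of t y z] mult_right_mono[of K L "\<bar>y - z\<bar>"] by (simp add: L_def)
  define rhs where "rhs z t = f (t0 + t) (y0 + exp (2 * L * \<bar>t\<bar>) * apply_bcontfun z t)"
    for z :: "real \<Rightarrow>\<^sub>C real" and t
  have cont_rhs: "continuous_on UNIV (rhs z)" for z
  proof -
    have "continuous_on UNIV ((\<lambda>(t, y). f t y) \<circ>
        (\<lambda>t. (t0 + t, y0 + exp (2 * L * \<bar>t\<bar>) * apply_bcontfun z t)))"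
      by (intro continuous_on_compose continuous_on_subset[OF cont] continuous_intros) auto
    thus ?thesis by (simp add: rhs_def[abs_def] comp_def)
  qed
  have "\<exists>G. G 0 = 0 \<and> (\<forall>t. (G has_real_derivative rhs z t) (at t))" for z
    using antiderivative_exists[OF cont_rhs[of z]] by metis
  then obtain G where G0: "\<And>z. G z 0 = 0"
    and G: "\<And>z t. (G z has_real_derivative rhs z t) (at t)"
    by metis
  define Pic where "Pic z t = exp (- (2 * L * \<bar>t\<bar>)) * G z t" for z t
  have cont_G: "continuous_on UNIV (G z)" for z
    using G by (meson DERIV_isCont continuous_at_imp_continuous_on)
  have "0 \<le> B" using bnd[of 0 0] by linarith
  have "Pic z \<in> bcontfun" for z
  proof (rule bcontfun_normI)
    show "continuous_on UNIV (Pic z)"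
      unfolding Pic_def by (intro continuous_intros cont_G)
    fix t
    have "\<bar>G z t\<bar> \<le> B / L / 2 * exp (2 * L * \<bar>t\<bar>)"
    proof (rule exp_weighted_bound[OF L _ G _ G0])
      show "0 \<le> B / L" using \<open>0 \<le> B\<close> L by simp
      fix s
      have "\<bar>rhs z s\<bar> \<le> B * 1" by (simp add: rhs_def bnd)
      also have "\<dots> \<le> B * exp (2 * L * \<bar>s\<bar>)"
        using \<open>0 \<le> B\<close> L by (intro mult_left_mono) auto
      finally show "\<bar>rhs z s\<bar> \<le> L * (B / L) * exp (2 * L * \<bar>s\<bar>)" using L by simp
    qed
    thus "norm (Pic z t) \<le> B / L / 2"
      by (simp add: Pic_def abs_mult exp_minus field_simps)
  qed
  hence app: "apply_bcontfun (Bcontfun (Pic z)) = Pic z" for z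
    by (simp add: Bcontfun_inverse)
  have contr: "dist (Bcontfun (Pic z1)) (Bcontfun (Pic z2)) \<le> 1 / 2 * dist z1 z2" for z1 z2
  proof (rule dist_bound)
    fix t
    have "\<bar>G z1 t - G z2 t\<bar> \<le> dist z1 z2 / 2 * exp (2 * L * \<bar>t\<bar>)"
    proof (rule exp_weighted_bound[OF L _ DERIV_diff[OF G G]])
      fix s
      have "\<bar>rhs z1 s - rhs z2 s\<bar> \<le> L * (exp (2 * L * \<bar>s\<bar>) * dist (apply_bcontfun z1 s) (apply_bcontfun z2 s))"
        unfolding rhs_def by (rule order_trans[OF lipL])
          (simp add: dist_real_def abs_mult flip: right_diff_distrib)
      also have "\<dots> \<le> L * (exp (2 * L * \<bar>s\<bar>) * dist z1 z2)"
        using L by (intro mult_left_mono dist_bounded) auto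
      finally show "\<bar>rhs z1 s - rhs z2 s\<bar> \<le> L * dist z1 z2 * exp (2 * L * \<bar>s\<bar>)"
        by (simp add: mult_ac)
    qed (auto simp: G0)
    moreover have "dist (Pic z1 t) (Pic z2 t) = exp (- (2 * L * \<bar>t\<bar>)) * \<bar>G z1 t - G z2 t\<bar>"
      by (simp add: Pic_def dist_real_def abs_mult flip: right_diff_distrib)
    ultimately have "dist (Pic z1 t) (Pic z2 t)
        \<le> exp (- (2 * L * \<bar>t\<bar>)) * (dist z1 z2 / 2 * exp (2 * L * \<bar>t\<bar>))"
      by (simp del: exp_le_cancel_iff)
    also have "\<dots> = 1 / 2 * dist z1 z2"
      by (simp add: exp_minus)
    finally show "dist (apply_bcontfun (Bcontfun (Pic z1)) t) (apply_bcontfun (Bcontfun (Pic z2)) t)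
        \<le> 1 / 2 * dist z1 z2"
      by (simp add: app)
  qed
  have "\<exists>!z. Bcontfun (Pic z) = z"
    by (rule banach_fix_type[where c = "1/2"]) (use contr in auto)
  then obtain z where z: "Bcontfun (Pic z) = z" by blast
  hence zt: "apply_bcontfun z t = exp (- (2 * L * \<bar>t\<bar>)) * G z t" for t
    using app[of z] by (simp add: Pic_def)
  have rhs_z: "rhs z t = f (t0 + t) (y0 + G z t)" for t
    by (simp add: rhs_def zt exp_minus field_simps)
  show ?thesis
  proof (intro exI[of _ "\<lambda>t. y0 + G z (t - t0)"] conjI allI)
    fix t
    have "((\<lambda>t. G z (t - t0)) has_real_derivative rhs z (t - t0)) (at t)"
      by (rule DERIV_chain2[OF G, where Db = 1, simplified])
         (auto intro!: derivative_eq_intros)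
    thus "((\<lambda>t. y0 + G z (t - t0)) has_real_derivative f t (y0 + G z (t - t0))) (at t)"
      by (auto intro!: derivative_eq_intros simp: rhs_z)
  qed (simp add: G0)
qed

section \<open>The angular equation\<close>

definition angular_rhs :: "real \<Rightarrow> real \<Rightarrow> real \<Rightarrow> real" where
  "angular_rhs a b y = a * (cos y)\<^sup>2 - b * (sin y)\<^sup>2"

lemma sin_squared_lipschitz: "\<bar>(sin x)\<^sup>2 - (sin y)\<^sup>2\<bar> \<le> \<bar>x - y\<bar>" for x y :: real
proof -
  have "(sin x)\<^sup>2 - (sin y)\<^sup>2 = sin (x + y) * sin (x - y)"
    by (simp add: sin_add sin_diff cos_squared_eq algebra_simps power2_eq_square[symmetric])
  also have "\<bar>\<dots>\<bar> \<le> 1 * \<bar>x - y\<bar>"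
    unfolding abs_mult by (intro mult_mono abs_sin_x_le_abs_x) auto
  finally show ?thesis by simp
qed

lemma angular_rhs_diff:
  "\<bar>angular_rhs a b y - angular_rhs a' b' z\<bar> \<le> (\<bar>a\<bar> + \<bar>b\<bar>) * \<bar>y - z\<bar> + (\<bar>a - a'\<bar> + \<bar>b - b'\<bar>)"
proof -
  have "angular_rhs a b y - angular_rhs a' b' z =
      - (a + b) * ((sin y)\<^sup>2 - (sin z)\<^sup>2) + (a - a') * (cos z)\<^sup>2 - (b - b') * (sin z)\<^sup>2"
    by (simp add: angular_rhs_def cos_squared_eq algebra_simps)
  also have "\<bar>\<dots>\<bar> \<le> \<bar>- (a + b) * ((sin y)\<^sup>2 - (sin z)\<^sup>2)\<bar> + \<bar>(a - a') * (cos z)\<^sup>2\<bar> +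
      \<bar>(b - b') * (sin z)\<^sup>2\<bar>"
    by linarith
  also have "\<dots> \<le> (\<bar>a\<bar> + \<bar>b\<bar>) * \<bar>y - z\<bar> + \<bar>a - a'\<bar> * 1 + \<bar>b - b'\<bar> * 1"
    unfolding abs_mult
    by (intro add_mono mult_mono sin_squared_lipschitz) (auto simp: abs_square_le_1)
  finally show ?thesis by simp
qed

lemma angular_rhs_bound: "\<bar>angular_rhs a b y\<bar> \<le> \<bar>a\<bar> + \<bar>b\<bar>"
proof -
  have "\<bar>angular_rhs a b y\<bar> \<le> \<bar>a * (cos y)\<^sup>2\<bar> + \<bar>b * (sin y)\<^sup>2\<bar>"
    unfolding angular_rhs_def by linarith
  also have "\<dots> \<le> \<bar>a\<bar> * 1 + \<bar>b\<bar> * 1"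
    unfolding abs_mult by (intro add_mono mult_mono) (auto simp: abs_square_le_1)
  finally show ?thesis by simp
qed

lemma angular_rhs_periodic: "angular_rhs a b (y + pi) = angular_rhs a b y"
  by (simp add: angular_rhs_def)

text \<open>Stability under changes of the initial angle and of the coefficients. With \<open>\<eta> = 0\<close> it is the Lipschitz
bound for the flow.\<close>

lemma angular_compare:
  assumes T: "0 \<le> T" "T \<le> 1"
    and cont: "continuous_on {0..T} y" "continuous_on {0..T} z"
    and y: "\<And>t. 0 < t \<Longrightarrow> t < T \<Longrightarrow> (y has_real_derivative angular_rhs a (b t) (y t)) (at t)"
    and z: "\<And>t. 0 < t \<Longrightarrow> t < T \<Longrightarrow> (z has_real_derivative angular_rhs a' (b' t) (z t)) (at t)"
    and K: "\<And>t. 0 < t \<Longrightarrow> t < T \<Longrightarrow> \<bar>a\<bar> + \<bar>b t\<bar> \<le> K"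
    and \<eta>: "\<And>t. 0 < t \<Longrightarrow> t < T \<Longrightarrow> \<bar>a - a'\<bar> + \<bar>b t - b' t\<bar> \<le> \<eta>"
    and "0 \<le> K" "0 \<le> \<eta>"
  shows "\<bar>y T - z T\<bar> \<le> (\<bar>y 0 - z 0\<bar> + \<eta>) * exp K"
proof -
  have "\<bar>y T - z T\<bar> \<le> (\<bar>y 0 - z 0\<bar> + \<eta> * T) * exp (K * T)"
  proof (rule gronwall[OF T(1) \<open>0 \<le> K\<close> \<open>0 \<le> \<eta>\<close>])
    fix t assume t: "0 < t" "t < T"
    show "((\<lambda>t. y t - z t) has_real_derivative
        angular_rhs a (b t) (y t) - angular_rhs a' (b' t) (z t)) (at t)"
      by (intro DERIV_diff y z t)
    show "\<bar>angular_rhs a (b t) (y t) - angular_rhs a' (b' t) (z t)\<bar> \<le> K * \<bar>y t - z t\<bar> + \<eta>"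
      by (rule order_trans[OF angular_rhs_diff])
         (intro add_mono mult_right_mono K[OF t] \<eta>[OF t] abs_ge_zero)
  qed (intro continuous_intros cont)
  also have "\<dots> \<le> (\<bar>y 0 - z 0\<bar> + \<eta>) * exp K"
    using T \<open>0 \<le> K\<close> \<open>0 \<le> \<eta>\<close> by (intro mult_mono add_mono) (auto simp: mult_left_le)
  finally show ?thesis .
qed

definition angular_solution :: "real \<Rightarrow> (real \<Rightarrow> real) \<Rightarrow> (real \<Rightarrow> real) \<Rightarrow> bool" where
  "angular_solution a b y \<longleftrightarrow> (\<forall>t. (y has_real_derivative angular_rhs a (b t) (y t)) (at t))"

text \<open>The value is meaningful when \<open>b\<close> is continuous and bounded, as in the locale \<open>angular_coefficients\<close>.\<close>

definition angular_flow :: "real \<Rightarrow> (real \<Rightarrow> real) \<Rightarrow> real \<Rightarrow> real \<Rightarrow> real" where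
  "angular_flow a b \<xi> = (THE y. angular_solution a b y \<and> y 0 = \<xi>)"

lemma angular_solution_continuous: "angular_solution a b y \<Longrightarrow> continuous_on S y"
  unfolding angular_solution_def by (meson DERIV_isCont continuous_at_imp_continuous_on)

text \<open>\<open>K\<close> bounds both the speed of the angle and the Lipschitz constant of the right-hand side.\<close>

locale angular_coefficients =
  fixes a :: real and b :: "real \<Rightarrow> real" and K :: real
  assumes continuous: "continuous_on UNIV b"
    and bounded: "\<And>t. \<bar>a\<bar> + \<bar>b t\<bar> \<le> K"
begin

lemma K_nonneg: "0 \<le> K"
  using bounded[of 0] by linarith

lemma solution_exists: obtains y where "angular_solution a b y" "y t0 = y0"
proof -
  have cont: "continuous_on UNIV (\<lambda>(t, y). angular_rhs a (b t) y)"
    unfolding angular_rhs_def split_beta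
    by (intro continuous_intros continuous_on_compose2[OF continuous]) auto
  have bnd: "\<bar>angular_rhs a (b t) y\<bar> \<le> K" for t y
    using angular_rhs_bound bounded order_trans by blast
  have lip: "\<bar>angular_rhs a (b t) y - angular_rhs a (b t) z\<bar> \<le> K * \<bar>y - z\<bar>" for t y z
    using order_trans[OF angular_rhs_diff[of a "b t" y a "b t" z]
        add_right_mono[OF mult_right_mono[OF bounded]]] by simp
  obtain y where "y t0 = y0 \<and> (\<forall>t. (y has_real_derivative angular_rhs a (b t) (y t)) (at t))"
    using lipschitz_ode_exists[where f = "\<lambda>t y. angular_rhs a (b t) y", OF cont bnd lip] by blast
  thus ?thesis
    by (intro that[of y]) (simp_all add: angular_solution_def)
qed

lemma solution_unique:
  assumes "angular_solution a b y" "angular_solution a b z" "y t0 = z t0"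
  shows "y = z"
proof (rule ext)
  fix t
  have "y t - z t = 0"
  proof (rule gronwall_zero[where u = "\<lambda>t. y t - z t" and t = t and ?t0.0 = t0, OF K_nonneg])
    show "((\<lambda>t. y t - z t) has_real_derivative
        angular_rhs a (b t) (y t) - angular_rhs a (b t) (z t)) (at t)" for t
      by (intro DERIV_diff) (use assms in \<open>auto simp: angular_solution_def\<close>)
    show "\<bar>angular_rhs a (b t) (y t) - angular_rhs a (b t) (z t)\<bar> \<le> K * \<bar>y t - z t\<bar>" for t
      using order_trans[OF angular_rhs_diff[of a "b t" "y t" a "b t" "z t"]
          add_right_mono[OF mult_right_mono[OF bounded]]] by simp
    show "y t0 - z t0 = 0" using assms by simp
  qed
  thus "y t = z t" by simp
qed

lemma flow: "angular_solution a b (angular_flow a b \<xi>)" "angular_flow a b \<xi> 0 = \<xi>"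
proof -
  obtain y where "angular_solution a b y" "y 0 = \<xi>"
    using solution_exists .
  hence "\<exists>!y. angular_solution a b y \<and> y 0 = \<xi>"
    using solution_unique[of _ _ 0] by metis
  from theI'[OF this] show "angular_solution a b (angular_flow a b \<xi>)" "angular_flow a b \<xi> 0 = \<xi>"
    by (simp_all add: angular_flow_def)
qed

lemma flow_eqI: "angular_solution a b y \<Longrightarrow> angular_flow a b (y 0) = y"
  using solution_unique[of _ _ 0] flow by metis

lemma flow_deriv:
  "(angular_flow a b \<xi> has_real_derivative angular_rhs a (b t) (angular_flow a b \<xi> t)) (at t)"
  using flow(1) by (simp add: angular_solution_def)

lemma flow_continuous: "continuous_on S (angular_flow a b \<xi>)"
  by (rule angular_solution_continuous[OF flow(1)])

lemma flow_surj: obtains \<xi> where "angular_flow a b \<xi> t = \<eta>"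
  using solution_exists[of t \<eta>] flow_eqI by metis

lemma flow_inj: "angular_flow a b \<xi> t = angular_flow a b \<xi>' t \<Longrightarrow> \<xi> = \<xi>'"
  using solution_unique[OF flow(1) flow(1)] flow(2) by metis

text \<open>Two solutions that change their order must meet, and solutions that meet coincide.\<close>

lemma flow_mono:
  assumes "\<xi> \<le> \<xi>'" "0 \<le> t"
  shows "angular_flow a b \<xi> t \<le> angular_flow a b \<xi>' t"
proof (rule ccontr)
  assume less: "\<not> ?thesis"
  define u where "u s = angular_flow a b \<xi>' s - angular_flow a b \<xi> s" for s
  have "continuous_on {0..t} u"
    unfolding u_def by (intro continuous_intros flow_continuous)
  moreover have "u t \<le> 0" "0 \<le> u 0"
    using assms less by (auto simp: u_def flow(2))
  ultimately obtain s where "u s = 0"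
    using IVT2'[of u t 0 0] \<open>0 \<le> t\<close> by blast
  hence "angular_flow a b \<xi>' = angular_flow a b \<xi>"
    by (intro solution_unique[OF flow(1) flow(1), of _ s]) (simp add: u_def)
  with less show False by simp
qed

lemma flow_periodic: "angular_flow a b (\<xi> + pi) t = angular_flow a b \<xi> t + pi"
proof -
  have "angular_solution a b (\<lambda>t. angular_flow a b \<xi> t + pi)"
    unfolding angular_solution_def angular_rhs_periodic
    by (auto intro!: derivative_eq_intros flow_deriv)
  from flow_eqI[OF this] show ?thesis by (simp add: flow(2))
qed

lemma flow_displacement:
  assumes "0 \<le> t" "t \<le> 1"
  shows "\<bar>angular_flow a b \<xi> t - \<xi>\<bar> \<le> K"
proof -
  have "\<bar>angular_flow a b \<xi> t - angular_flow a b \<xi> 0\<bar> \<le> K * \<bar>t - 0\<bar>"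
    using field_differentiable_bound[of UNIV "angular_flow a b \<xi>"
        "\<lambda>t. angular_rhs a (b t) (angular_flow a b \<xi> t)" K t 0]
      flow_deriv order_trans[OF angular_rhs_bound bounded] by simp
  also have "\<dots> \<le> K" using assms K_nonneg by (simp add: mult_left_le)
  finally show ?thesis by (simp add: flow(2))
qed

lemma flow_compare:
  assumes "angular_coefficients a' b' K'" "0 \<le> \<eta>"
    and "\<And>t. 0 < t \<Longrightarrow> t < 1 \<Longrightarrow> \<bar>a - a'\<bar> + \<bar>b t - b' t\<bar> \<le> \<eta>"
  shows "\<bar>angular_flow a b \<xi> 1 - angular_flow a' b' \<xi>' 1\<bar> \<le> (\<bar>\<xi> - \<xi>'\<bar> + \<eta>) * exp K"
proof -
  interpret other: angular_coefficients a' b' K' by fact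
  show ?thesis
    using angular_compare[of 1 "angular_flow a b \<xi>" "angular_flow a' b' \<xi>'" a b a' b' K \<eta>]
      flow_deriv other.flow_deriv flow_continuous other.flow_continuous bounded assms K_nonneg
    by (simp add: flow(2) other.flow(2))
qed

text \<open>Between two jumps the angle satisfies its equation in the open segment only and has one-sided limits
at the ends. The comparison on the closed unit interval identifies such an angle with the flow.\<close>

lemma flow_unique_on_segment:
  assumes cont: "continuous_on {0..1} y"
    and deriv: "\<And>t. 0 < t \<Longrightarrow> t < 1 \<Longrightarrow> (y has_real_derivative angular_rhs a (b t) (y t)) (at t)"
    and t: "0 \<le> t" "t \<le> 1"
  shows "y t = angular_flow a b (y 0) t"
proof -
  have "\<bar>y t - angular_flow a b (y 0) t\<bar> \<le> (\<bar>y 0 - angular_flow a b (y 0) 0\<bar> + 0) * exp K"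
    using t by (intro angular_compare[where b = b and b' = b and a = a and a' = a] flow_deriv
      flow_continuous bounded K_nonneg deriv continuous_on_subset[OF cont]) auto
  thus ?thesis by (simp add: flow(2))
qed

end

section \<open>The jump of the angle\<close>

lemma angular_coefficients_jump: "angular_coefficients 0 (\<lambda>_. c) \<bar>c\<bar>"
  by unfold_locales auto

text \<open>Two branches differ by a continuous function with values in \<open>2\<pi>\<int>\<close>.\<close>

lemma branch_unique:
  assumes "branch c \<Xi> \<phi>" "branch c \<Xi> \<psi>" "\<tau> \<in> {0..1}"
  shows "\<phi> \<tau> = \<psi> \<tau>"
proof -
  define u where "u t = \<phi> t - \<psi> t" for t
  have cont: "continuous_on {0..1} u"
    unfolding u_def using assms by (intro continuous_intros) (auto simp: branch_def)
  have integral: "\<exists>n::int. u t = of_int n * 2 * pi" if t: "t \<in> {0..1}" for t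
  proof -
    define z where "z = Complex (cos \<Xi> + t * c * sin \<Xi>) (sin \<Xi>)"
    have "z \<noteq> 0"
      using sin_zero_norm_cos_one[of \<Xi>] by (auto simp: z_def complex_eq_iff)
    moreover have "z = of_real (cmod z) * cis (\<phi> t)" "z = of_real (cmod z) * cis (\<psi> t)"
      using assms(1,2) t unfolding branch_def z_def Let_def by blast+
    ultimately have "cis (\<phi> t) = cis (\<psi> t)"
      by (metis mult_cancel_left norm_eq_zero of_real_eq_0_iff)
    hence "cis (u t) = 1"
      by (simp add: u_def flip: cis_divide)
    hence "cos (u t) = 1" by (metis cis.sel(1) one_complex.sel(1))
    thus ?thesis by (simp add: cos_one_2pi_int)
  qed
  have "u constant_on {0..1}"
  proof (rule continuous_discrete_range_constant[OF connected_Icc cont])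
    fix x :: real assume x: "x \<in> {0..1}"
    show "\<exists>e>0. \<forall>y. y \<in> {0..1} \<and> u y \<noteq> u x \<longrightarrow> e \<le> norm (u y - u x)"
    proof (intro exI[of _ "2 * pi"] conjI allI impI)
      fix y assume y: "y \<in> {0..1} \<and> u y \<noteq> u x"
      obtain n k :: int where nk: "u x = of_int n * 2 * pi" "u y = of_int k * 2 * pi"
        using integral x y by blast
      with y have "1 \<le> \<bar>k - n\<bar>" by auto
      hence "1 * (2 * pi) \<le> real_of_int \<bar>k - n\<bar> * (2 * pi)"
        by (intro mult_right_mono) (linarith, simp)
      also have "\<dots> = \<bar>u y - u x\<bar>"
      proof -
        have "u y - u x = real_of_int (k - n) * (2 * pi)"
          by (simp add: nk algebra_simps)
        thus ?thesis by (simp add: abs_mult)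
      qed
      finally show "2 * pi \<le> norm (u y - u x)" by simp
    qed simp
  qed
  hence "u \<tau> = u 0" using assms(3) unfolding constant_on_def by fastforce
  thus ?thesis using assms(1,2) by (simp add: u_def branch_def)
qed

text \<open>The vector \<open>(x, s)\<close> in the frame obtained by rotating through the angle with sine \<open>S\<close> and cosine \<open>C\<close>.\<close>

lemma rotated_vector_identities:
  fixes x s S C :: real
  assumes "S\<^sup>2 + C\<^sup>2 = 1"
  shows "(x * C + s * S)\<^sup>2 + (x * S - s * C)\<^sup>2 = x\<^sup>2 + s\<^sup>2"
    and "(x * C + s * S) * C + (x * S - s * C) * S = x"
    and "(x * C + s * S) * S - (x * S - s * C) * C = s"
proof -
  have "(x * C + s * S)\<^sup>2 + (x * S - s * C)\<^sup>2 = (x\<^sup>2 + s\<^sup>2) * (S\<^sup>2 + C\<^sup>2)"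
    "(x * C + s * S) * C + (x * S - s * C) * S = x * (S\<^sup>2 + C\<^sup>2)"
    "(x * C + s * S) * S - (x * S - s * C) * C = s * (S\<^sup>2 + C\<^sup>2)"
    by (simp_all add: power2_eq_square algebra_simps)
  thus "(x * C + s * S)\<^sup>2 + (x * S - s * C)\<^sup>2 = x\<^sup>2 + s\<^sup>2"
    "(x * C + s * S) * C + (x * S - s * C) * S = x"
    "(x * C + s * S) * S - (x * S - s * C) * C = s"
    using assms by simp_all
qed

text \<open>The component \<open>w\<close> of the path \<open>cos \<Xi> + \<tau> c sin \<Xi> + i sin \<Xi>\<close> perpendicular to the direction \<open>y(\<tau>)\<close>
solves a homogeneous linear equation with initial value \<open>0\<close>, so it vanishes. The component \<open>P\<close> along
\<open>y(\<tau>)\<close> is then the modulus up to sign. It starts at \<open>1\<close> and has no zero, so it is positive.\<close>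

lemma branch_flow: "branch c \<Xi> (angular_flow 0 (\<lambda>_. c) \<Xi>)"
proof -
  interpret angular_coefficients 0 "\<lambda>_. c" "\<bar>c\<bar>" by (rule angular_coefficients_jump)
  define y where "y = angular_flow 0 (\<lambda>_. c) \<Xi>"
  define x where "x t = cos \<Xi> + t * c * sin \<Xi>" for t
  have dy: "(y has_real_derivative - c * (sin (y t))\<^sup>2) (at t)" for t
    using flow_deriv[of \<Xi> t] by (simp add: y_def angular_rhs_def)
  have y0: "y 0 = \<Xi>" by (simp add: y_def flow)
  have dx: "(x has_real_derivative c * sin \<Xi>) (at t)" for t
    unfolding x_def by (auto intro!: derivative_eq_intros)
  define w where "w t = x t * sin (y t) - sin \<Xi> * cos (y t)" for t
  have dw: "(w has_real_derivative - c * sin (y t) * cos (y t) * w t) (at t)" for t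
  proof -
    have identity: "c * s * S + v * (C * (- c * S\<^sup>2)) - s * (- S * (- c * S\<^sup>2)) = - c * S * C * (v * S - s * C)"
      if SC: "S\<^sup>2 + C\<^sup>2 = 1" for s S v C :: real
    proof -
      have "c * s * S + v * (C * (- c * S\<^sup>2)) - s * (- S * (- c * S\<^sup>2)) =
          - c * S * C * (v * S - s * C) + c * s * S * (1 - (S\<^sup>2 + C\<^sup>2))"
        by (simp add: power2_eq_square algebra_simps)
      thus ?thesis by (simp add: SC)
    qed
    have "(w has_real_derivative c * sin \<Xi> * sin (y t) +
        x t * (cos (y t) * (- c * (sin (y t))\<^sup>2)) -
        sin \<Xi> * (- sin (y t) * (- c * (sin (y t))\<^sup>2))) (at t)"
      unfolding w_def by (auto intro!: derivative_eq_intros dy dx simp: algebra_simps)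
    from DERIV_cong[OF this identity[OF sin_cos_squared_add]] show ?thesis
      by (simp only: w_def)
  qed
  have w: "w t = 0" for t
  proof (rule gronwall_zero[OF _ dw])
    show "\<bar>- c * sin (y t) * cos (y t) * w t\<bar> \<le> \<bar>c\<bar> * \<bar>w t\<bar>" for t
    proof -
      have "\<bar>sin (y t)\<bar> * \<bar>cos (y t)\<bar> \<le> 1" by (intro mult_le_one) auto
      hence "\<bar>c\<bar> * \<bar>w t\<bar> * (\<bar>sin (y t)\<bar> * \<bar>cos (y t)\<bar>) \<le> \<bar>c\<bar> * \<bar>w t\<bar>"
        by (intro mult_left_le) auto
      thus ?thesis by (simp add: abs_mult mult_ac)
    qed
    show "w 0 = 0" by (simp add: w_def x_def y0)
  qed auto
  define P where "P t = x t * cos (y t) + sin \<Xi> * sin (y t)" for t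
  have norm_eq: "(P t)\<^sup>2 = (cmod (Complex (x t) (sin \<Xi>)))\<^sup>2" for t
  proof -
    have "(P t)\<^sup>2 + (w t)\<^sup>2 = (x t)\<^sup>2 + (sin \<Xi>)\<^sup>2"
      unfolding P_def w_def by (rule rotated_vector_identities) simp
    thus ?thesis by (simp add: w cmod_power2)
  qed
  have Pnz: "P t \<noteq> 0" for t
  proof
    assume "P t = 0"
    hence "x t = 0" "sin \<Xi> = 0" using norm_eq[of t] by (auto simp: complex_eq_iff)
    thus False using sin_zero_norm_cos_one[of \<Xi>] by (auto simp: x_def)
  qed
  have contP: "continuous_on S P" for S
    unfolding P_def x_def
    by (intro continuous_intros) (simp_all add: y_def flow_continuous)
  have P0: "P 0 = 1"
    by (simp add: P_def x_def y0 flip: power2_eq_square)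
  have Ppos: "0 < P t" if t: "t \<in> {0..1}" for t
  proof (rule ccontr)
    assume "\<not> 0 < P t"
    then obtain s where "P s = 0"
      using IVT2'[of P t 0 0] contP P0 t by auto
    with Pnz show False by blast
  qed
  have "Complex (x t) (sin \<Xi>) = of_real (cmod (Complex (x t) (sin \<Xi>))) * cis (y t)"
    if t: "t \<in> {0..1}" for t
  proof -
    have "cmod (Complex (x t) (sin \<Xi>)) = P t"
      using norm_eq[of t] Ppos[OF t] by (simp add: power2_eq_iff_nonneg)
    moreover have "x t = P t * cos (y t)"
    proof -
      have "P t * cos (y t) + w t * sin (y t) = x t"
        unfolding P_def w_def by (rule rotated_vector_identities) simp
      thus ?thesis by (simp add: w)
    qed
    moreover have "sin \<Xi> = P t * sin (y t)"
    proof -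
      have "P t * sin (y t) - w t * cos (y t) = sin \<Xi>"
        unfolding P_def w_def by (rule rotated_vector_identities) simp
      thus ?thesis by (simp add: w)
    qed
    ultimately show ?thesis by (simp add: complex_eq_iff)
  qed
  thus ?thesis
    using flow_continuous[of "{0..1}" \<Xi>] y0 by (auto simp: branch_def Let_def y_def x_def)
qed

lemma angle_F_eq_flow:
  assumes "\<tau> \<in> {0..1}"
  shows "angle_F c \<tau> \<Xi> = angular_flow 0 (\<lambda>_. c) \<Xi> \<tau>"
  unfolding angle_F_def
proof (rule the_equality)
  show "\<exists>\<phi>. branch c \<Xi> \<phi> \<and> \<phi> \<tau> = angular_flow 0 (\<lambda>_. c) \<Xi> \<tau>"
    using branch_flow by blast
  show "y = angular_flow 0 (\<lambda>_. c) \<Xi> \<tau>" if "\<exists>\<phi>. branch c \<Xi> \<phi> \<and> \<phi> \<tau> = y" for y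
  proof -
    from that obtain \<phi> where "branch c \<Xi> \<phi>" "\<phi> \<tau> = y" by blast
    thus ?thesis using branch_unique[OF _ branch_flow assms] by blast
  qed
qed

lemma angle_J_eq_flow: "\<Xi> + angle_J c \<Xi> = angular_flow 0 (\<lambda>_. c) \<Xi> 1"
proof -
  interpret angular_coefficients 0 "\<lambda>_. c" "\<bar>c\<bar>" by (rule angular_coefficients_jump)
  show ?thesis by (simp add: angle_J_def angle_F_eq_flow flow)
qed

section \<open>Drift of almost periodic sequences of circle maps\<close>

fun orbit :: "(nat \<Rightarrow> real \<Rightarrow> real) \<Rightarrow> nat \<Rightarrow> nat \<Rightarrow> real \<Rightarrow> real" where
  "orbit G s 0 x = x"
| "orbit G s (Suc N) x = G (s + N) (orbit G s N x)"

lemma orbit_add: "orbit G s (N + K) x = orbit G (s + N) K (orbit G s N x)"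
  by (induction K) (auto simp: add.assoc)

text \<open>\<open>G n\<close> are lifts of circle maps of degree one, for the circle of length \<open>\<pi>\<close>: the direction of a vector
\<open>(\<psi>', \<psi>)\<close> up to sign determines its angle modulo \<open>\<pi>\<close>. The bound in \<open>almost_periodic\<close> holds for all later
indices at once, as for Bohr almost periodic sequences.\<close>

locale circle_lifts =
  fixes G :: "nat \<Rightarrow> real \<Rightarrow> real" and C L :: real
  assumes mono: "x \<le> y \<Longrightarrow> G n x \<le> G n y"
    and equivariant: "G n (x + pi) = G n x + pi"
    and displacement: "\<bar>G n x - x\<bar> \<le> C"
    and lipschitz: "\<bar>G n x - G n y\<bar> \<le> L * \<bar>x - y\<bar>"
    and one_le_L: "1 \<le> L"
    and almost_periodic: "0 < \<epsilon> \<Longrightarrow>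
      \<exists>T. finite T \<and> (\<forall>s. \<exists>t\<in>T. \<forall>n x. \<bar>G (s + n) x - G (t + n) x\<bar> \<le> \<epsilon>)"
begin

lemma C_nonneg: "0 \<le> C"
  using displacement[of 0 0] by linarith

lemma orbit_mono: "x \<le> y \<Longrightarrow> orbit G s N x \<le> orbit G s N y"
  by (induction N) (auto intro: mono)

lemma orbit_add_pi: "orbit G s N (x + pi) = orbit G s N x + pi"
  by (induction N) (auto simp: equivariant)

lemma orbit_add_int_pi: "orbit G s N (x + of_int k * pi) = orbit G s N x + of_int k * pi"
proof (induction k rule: int_induct[where k = 0])
  case (step1 i)
  thus ?case using orbit_add_pi[of s N "x + of_int i * pi"] by (simp add: algebra_simps)
next
  case (step2 i)
  thus ?case using orbit_add_pi[of s N "x + of_int (i - 1) * pi"] by (simp add: algebra_simps)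
qed simp

lemma orbit_displacement: "\<bar>orbit G s N x - x\<bar> \<le> real N * C"
proof (induction N)
  case (Suc N)
  have "\<bar>orbit G s (Suc N) x - x\<bar> \<le>
      \<bar>G (s + N) (orbit G s N x) - orbit G s N x\<bar> + \<bar>orbit G s N x - x\<bar>" by simp
  also have "\<dots> \<le> C + real N * C" by (intro add_mono displacement Suc)
  finally show ?case by (simp add: algebra_simps)
qed simp

text \<open>Squeeze \<open>x\<close> between two consecutive translates of \<open>y\<close> by multiples of \<open>\<pi>\<close>.\<close>

lemma displacement_oscillation:
  "\<bar>(orbit G s N x - x) - (orbit G s N y - y)\<bar> \<le> pi"
proof -
  define k where "k = \<lfloor>(x - y) / pi\<rfloor>"
  have "of_int k \<le> (x - y) / pi" "(x - y) / pi \<le> of_int (k + 1)"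
    unfolding k_def by linarith+
  hence k: "y + of_int k * pi \<le> x" "x \<le> y + of_int (k + 1) * pi"
    using pi_gt_zero by (simp_all add: field_simps)
  from orbit_mono[OF k(1), of s N] orbit_mono[OF k(2), of s N] k show ?thesis
    unfolding orbit_add_int_pi by (simp add: algebra_simps abs_le_iff)
qed

text \<open>The starting angle \<open>0\<close> stands for all others, up to an error \<open>\<pi>\<close>. In the following bounds \<open>\<pi>\<close> is
rounded up to \<open>4\<close>.\<close>

definition drift :: "nat \<Rightarrow> nat \<Rightarrow> real" where
  "drift s N = orbit G s N 0"

lemma drift_add: "\<bar>drift s (N + K) - (drift s N + drift (s + N) K)\<bar> \<le> 4"
  using displacement_oscillation[of "s + N" K "drift s N" 0] pi_less_4
  by (simp add: drift_def orbit_add)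

lemma drift_bound: "\<bar>drift s N\<bar> \<le> real N * C"
  using orbit_displacement[of s N 0] by (simp add: drift_def)

lemma orbit_close:
  assumes close: "\<And>n x. \<bar>G (s + n) x - G (t + n) x\<bar> \<le> \<epsilon>"
  shows "\<bar>orbit G (s + j) N x - orbit G (t + j) N x\<bar> \<le> real N * \<epsilon> * L ^ N"
proof (induction N)
  case (Suc N)
  let ?x = "orbit G (s + j) N x" and ?y = "orbit G (t + j) N x"
  have "0 \<le> \<epsilon>" using close[of 0 0] by linarith
  have "\<bar>orbit G (s + j) (Suc N) x - orbit G (t + j) (Suc N) x\<bar> \<le>
      \<bar>G (s + (j + N)) ?x - G (s + (j + N)) ?y\<bar> + \<bar>G (s + (j + N)) ?y - G (t + (j + N)) ?y\<bar>"
    by (simp add: add.assoc)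
  also have "\<dots> \<le> L * (real N * \<epsilon> * L ^ N) + \<epsilon> * 1"
    using Suc one_le_L
    by (intro add_mono order_trans[OF lipschitz] mult_left_mono) (auto intro: close)
  also have "\<dots> \<le> L * (real N * \<epsilon> * L ^ N) + \<epsilon> * L ^ Suc N"
    using one_le_L \<open>0 \<le> \<epsilon>\<close> by (intro add_left_mono mult_left_mono one_le_power)
  finally show ?case by (simp add: algebra_simps)
qed simp

text \<open>The hypothesis makes \<open>k\<close> consecutive steps of the two tails agree within \<open>1\<close>. Each block of length \<open>k\<close>
adds this error and two errors \<open>4\<close> from cutting the two orbits, in total \<open>9\<close>.\<close>

lemma drift_close:
  assumes k: "0 < k"
    and close: "\<And>n x. \<bar>G (s + n) x - G (t + n) x\<bar> \<le> 1 / (real k * L ^ k)"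
  shows "\<bar>drift s N - drift t N\<bar> \<le> 9 * (real N / real k) + 1"
proof -
  have short: "\<bar>drift (s + j) R - drift (t + j) R\<bar> \<le> 1" if "R \<le> k" for j R
  proof -
    have "\<bar>drift (s + j) R - drift (t + j) R\<bar> \<le> real R * (1 / (real k * L ^ k)) * L ^ R"
      unfolding drift_def by (rule orbit_close[OF close])
    also have "\<dots> \<le> real k * (1 / (real k * L ^ k)) * L ^ k"
      using that one_le_L k by (intro mult_mono power_increasing) auto
    also have "\<dots> = 1" using k one_le_L by simp
    finally show ?thesis .
  qed
  have blocks: "\<bar>drift (s + j) (n * k + R) - drift (t + j) (n * k + R)\<bar> \<le> 9 * real n + 1"
    if "R \<le> k" for j n R
  proof (induction n arbitrary: j)
    case 0
    thus ?case using short[OF that] by simp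
  next
    case (Suc n)
    have "\<bar>drift (s + (j + k)) (n * k + R) - drift (t + (j + k)) (n * k + R)\<bar> \<le> 9 * real n + 1"
      by (rule Suc)
    moreover have "\<bar>drift (s + j) k - drift (t + j) k\<bar> \<le> 1" by (rule short) simp
    ultimately show ?case
      using drift_add[of "s + j" k "n * k + R"] drift_add[of "t + j" k "n * k + R"]
      by (simp add: add.assoc abs_le_iff)
  qed
  have "\<bar>drift s N - drift t N\<bar> \<le> 9 * real (N div k) + 1"
    using blocks[of "N mod k" 0 "N div k"] k by simp
  also have "real (N div k) \<le> real N / real k" by (rule of_nat_div_le_of_nat)
  finally show ?thesis by simp
qed

text \<open>Almost periodicity replaces \<open>s\<close> by one of finitely many \<open>t\<close>. The index ranges from \<open>t\<close> to \<open>t + N\<close> and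
from \<open>0\<close> to \<open>N\<close> then differ by at most \<open>t\<close> indices at either end, which cost a constant.\<close>

lemma drift_uniform:
  assumes k: "0 < k"
  shows "\<exists>A. \<forall>s N. \<bar>drift s N - drift 0 N\<bar> \<le> 9 * (real N / real k) + A"
proof -
  have "0 < 1 / (real k * L ^ k)" using k one_le_L by simp
  from almost_periodic[OF this] obtain T where "finite T"
    and T: "\<And>s. \<exists>t\<in>T. \<forall>n x. \<bar>G (s + n) x - G (t + n) x\<bar> \<le> 1 / (real k * L ^ k)"
    by blast
  obtain t_max where t_max: "\<And>t. t \<in> T \<Longrightarrow> t \<le> t_max"
    using \<open>finite T\<close> by (metis finite_nat_set_iff_bounded_le)
  have "\<bar>drift s N - drift 0 N\<bar> \<le> 9 * (real N / real k) + (9 + 2 * (real t_max * C))" for s N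
  proof -
    obtain t where "t \<in> T" and t: "\<And>n x. \<bar>G (s + n) x - G (t + n) x\<bar> \<le> 1 / (real k * L ^ k)"
      using T by blast
    have "\<bar>drift s N - drift t N\<bar> \<le> 9 * (real N / real k) + 1"
      by (rule drift_close[OF k t])
    moreover have "\<bar>drift 0 (t + N) - (drift 0 t + drift t N)\<bar> \<le> 4"
      "\<bar>drift 0 (t + N) - (drift 0 N + drift N t)\<bar> \<le> 4"
      using drift_add[of 0 t N] drift_add[of 0 N t] by (simp_all add: add.commute)
    moreover have "\<bar>drift s' t\<bar> \<le> real t_max * C" for s'
      using drift_bound[of s' t] mult_right_mono[of "real t" "real t_max" C]
        t_max[OF \<open>t \<in> T\<close>] C_nonneg by simp
    note this[of 0] this[of N]
    ultimately show ?thesis by linarith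
  qed
  thus ?thesis by blast
qed

lemma drift_multiple:
  assumes A: "\<And>s N. \<bar>drift s N - drift 0 N\<bar> \<le> 9 * (real N / real k) + A"
  shows "\<bar>drift 0 (n * N) - real n * drift 0 N\<bar> \<le> real n * (9 * (real N / real k) + A + 4)"
proof (induction n)
  case 0
  thus ?case by (simp add: drift_def)
next
  case (Suc n)
  have "drift 0 (Suc n * N) - real (Suc n) * drift 0 N =
      (drift 0 (n * N + N) - (drift 0 (n * N) + drift (n * N) N)) +
      (drift (n * N) N - drift 0 N) + (drift 0 (n * N) - real n * drift 0 N)"
    by (simp add: algebra_simps)
  moreover have "\<bar>drift 0 (n * N + N) - (drift 0 (n * N) + drift (n * N) N)\<bar> \<le> 4"
    using drift_add[of 0 "n * N" N] by simp
  moreover have "real (Suc n) * (9 * (real N / real k) + A + 4) =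
      real n * (9 * (real N / real k) + A + 4) + (9 * (real N / real k) + A + 4)"
    by (simp only: of_nat_Suc distrib_right mult_1)
  ultimately show ?case
    using A[of "n * N" N] Suc by linarith
qed

text \<open>Both \<open>drift 0 N / N\<close> and \<open>drift 0 N' / N'\<close> are compared with \<open>drift 0 (N N') / (N N')\<close>.\<close>

lemma drift_rate_Cauchy: "Cauchy (\<lambda>N. drift 0 N / real N)"
proof (rule metric_CauchyI)
  fix e :: real assume "0 < e"
  \<comment> \<open>\<open>k\<close> and \<open>N0\<close> make the two error terms \<open>9 / k\<close> and \<open>(A + 4) / N\<close> smaller than \<open>e / 4\<close>.\<close>
  obtain k :: nat where k: "36 / e < real k" using reals_Archimedean2 by blast
  hence k0: "0 < k" using \<open>0 < e\<close> by (metis divide_pos_pos less_trans of_nat_0_less_iff zero_less_numeral)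
  obtain A where A: "\<And>s N. \<bar>drift s N - drift 0 N\<bar> \<le> 9 * (real N / real k) + A"
    using drift_uniform[OF k0] by blast
  obtain N0 :: nat where N0: "4 * (A + 4) / e < real N0" using reals_Archimedean2 by blast
  have near: "\<bar>drift 0 (n * N) / real (n * N) - drift 0 N / real N\<bar> < e / 2"
    if "0 < n" "0 < N" "N0 \<le> N" for n N
  proof -
    have "drift 0 (n * N) / real (n * N) - drift 0 N / real N =
        (drift 0 (n * N) - real n * drift 0 N) / (real n * real N)"
      using that by (simp add: field_simps)
    also have "\<bar>\<dots>\<bar> \<le> real n * (9 * (real N / real k) + A + 4) / (real n * real N)"
      unfolding abs_divide using drift_multiple[OF A, of n N]
      by (simp only: abs_mult abs_of_nat) (intro divide_right_mono, auto)
    also have "\<dots> = 9 / real k + (A + 4) / real N"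
      using that k0 by (simp add: field_simps)
    also have "\<dots> < e / 4 + e / 4"
    proof (rule add_strict_mono)
      show "9 / real k < e / 4" using k k0 \<open>0 < e\<close> by (simp add: field_simps)
      have "4 * (A + 4) / e < real N" using N0 that by linarith
      thus "(A + 4) / real N < e / 4" using that \<open>0 < e\<close> by (simp add: field_simps)
    qed
    finally show ?thesis by simp
  qed
  show "\<exists>N1. \<forall>N\<ge>N1. \<forall>N'\<ge>N1. dist (drift 0 N / real N) (drift 0 N' / real N') < e"
  proof (intro exI[of _ "Suc N0"] allI impI)
    fix N N' assume N: "Suc N0 \<le> N" "Suc N0 \<le> N'"
    show "dist (drift 0 N / real N) (drift 0 N' / real N') < e"
    proof -
      have pos: "0 < N" "0 < N'" and large: "N0 \<le> N" "N0 \<le> N'" using N by auto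
      have "\<bar>b - c\<bar> < e" if "\<bar>a - b\<bar> < e / 2" "\<bar>a - c\<bar> < e / 2" for a b c :: real
        using that by linarith
      from this[OF near[OF pos(2,1) large(1)]] near[OF pos large(2)] show ?thesis
        unfolding dist_real_def mult.commute[of N' N] by blast
    qed
  qed
qed

theorem orbit_rate_convergent:
  "\<exists>\<rho>. \<forall>x. (\<lambda>N. (orbit G 0 N x - x) / real N) \<longlonglongrightarrow> \<rho>"
proof -
  obtain \<rho> where \<rho>: "(\<lambda>N. drift 0 N / real N) \<longlonglongrightarrow> \<rho>"
    using drift_rate_Cauchy Cauchy_convergent convergent_def by blast
  have "(\<lambda>N. (orbit G 0 N x - x) / real N) \<longlonglongrightarrow> \<rho>" for x
  proof -
    have "(\<lambda>N. ((orbit G 0 N x - x) - drift 0 N) / real N) \<longlonglongrightarrow> 0"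
    proof (rule Lim_null_comparison)
      show "\<forall>\<^sub>F N in sequentially. norm (((orbit G 0 N x - x) - drift 0 N) / real N) \<le> pi / real N"
        using displacement_oscillation[of 0 _ x 0]
        by (intro always_eventually) (auto simp: drift_def divide_right_mono)
      show "(\<lambda>N. pi / real N) \<longlonglongrightarrow> 0" by (rule lim_const_over_n)
    qed
    from tendsto_add[OF this \<rho>] show ?thesis
      by (simp flip: add_divide_distrib)
  qed
  thus ?thesis by blast
qed

end

section \<open>Point sets\<close>

lemma point_sets_gap:
  assumes "X \<in> point_sets m M"
  shows "m \<le> X (i + 1) - X i" "X (i + 1) - X i \<le> M"
  using assms unfolding point_sets_def by (force dest: spec[of _ "i + 1"])+

lemma point_sets_growth:
  assumes X: "X \<in> point_sets m M" and "i \<le> j"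
  shows "m * of_int (j - i) \<le> X j - X i" "X j - X i \<le> M * of_int (j - i)"
  using \<open>i \<le> j\<close>
proof (induction j rule: int_ge_induct)
  case (step j)
  {
    case 1 show ?case using step(2) point_sets_gap(1)[OF X, of j] by (simp add: algebra_simps)
  next
    case 2 show ?case using step(3) point_sets_gap(2)[OF X, of j] by (simp add: algebra_simps)
  }
qed auto

lemma point_sets_less:
  assumes "X \<in> point_sets m M" "0 < m" "i < j"
  shows "X i + m \<le> X j"
proof -
  have "m * 1 \<le> m * of_int (j - i)"
    using assms by (intro mult_left_mono) auto
  thus ?thesis using point_sets_growth(1)[OF assms(1), of i j] assms(3) by linarith
qed

lemma point_sets_strict_mono:
  assumes "X \<in> point_sets m M" "0 < m"
  shows "strict_mono X"
  by (rule strict_monoI) (use point_sets_less[OF assms] assms(2) in fastforce)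

lemma point_sets_gap_free:
  assumes "X \<in> point_sets m M" "0 < m" "x \<in> {X n<..<X (n + 1)}"
  shows "x \<notin> range X"
proof
  assume "x \<in> range X"
  then obtain i where "x = X i" by blast
  with assms(3) have "n < i" "i < n + 1"
    using strict_mono_less[OF point_sets_strict_mono[OF assms(1,2)]] by auto
  thus False by simp
qed

lemma point_sets_index:
  assumes X: "X \<in> point_sets m M" and m: "0 < m"
  shows "\<exists>!n. X n \<le> x \<and> x < X (n + 1)"
proof -
  define K where "K = \<lceil>\<bar>x\<bar> / m\<rceil> + 1"
  have "\<bar>x\<bar> / m < of_int K" unfolding K_def by linarith
  hence xK: "\<bar>x\<bar> < m * of_int K" using m by (simp add: field_simps)
  have K: "0 < K" using m unfolding K_def by (smt (verit) ceiling_divide_lower divide_nonneg_pos zero_le_ceiling)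
  have X0: "X 0 = 0" using X by (simp add: point_sets_def)
  have low: "X (- K) \<le> x" and high: "x < X K"
    using point_sets_growth(1)[OF X, of "- K" 0] point_sets_growth(1)[OF X, of 0 K] xK K X0 by auto
  define k where "k = (LEAST k. x < X (- K + int k))"
  have "x < X (- K + int (nat (2 * K)))" using high K by simp
  hence k: "x < X (- K + int k)" unfolding k_def by (rule LeastI)
  hence "k \<noteq> 0" using low by (metis add.right_neutral linorder_not_le of_nat_0)
  hence "\<not> x < X (- K + int (k - 1))" unfolding k_def by (intro not_less_Least) simp
  hence ex: "X (- K + int k - 1) \<le> x \<and> x < X (- K + int k - 1 + 1)"
    using k \<open>k \<noteq> 0\<close> by (simp add: of_nat_diff algebra_simps)
  have mono: "X i \<le> X j" if "i \<le> j" for i j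
    using strict_mono_less_eq[OF point_sets_strict_mono[OF X m]] that by simp
  show ?thesis
  proof (rule ex1I[where a = "- K + int k - 1"])
    show "X (- K + int k - 1) \<le> x \<and> x < X (- K + int k - 1 + 1)" by (rule ex)
    fix n assume n: "X n \<le> x \<and> x < X (n + 1)"
    show "n = - K + int k - 1"
    proof (rule ccontr)
      assume "n \<noteq> - K + int k - 1"
      hence "n + 1 \<le> - K + int k - 1 \<or> - K + int k - 1 + 1 \<le> n" by linarith
      thus False using mono n ex by (meson linorder_not_le order_trans)
    qed
  qed
qed

lemma point_sets_translate:
  "X \<in> point_sets m M \<Longrightarrow> (\<lambda>i. X (i + \<tau>) - X \<tau>) \<in> point_sets m M"
  unfolding point_sets_def by (auto simp: algebra_simps dest!: spec[of _ "_ + \<tau>"])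

text \<open>The inner infima are at most \<open>M\<close>, because the gaps of the other set are. So their supremum is an upper
bound, which the supremum of an unbounded set of reals need not be.\<close>

lemma near_point:
  assumes X: "X \<in> point_sets m M" and Y: "Y \<in> point_sets m M" and m: "0 < m"
    and less: "(SUP i. INF j. \<bar>X i - Y j\<bar>) < r"
  obtains j where "\<bar>X i - Y j\<bar> < r"
proof -
  have bdd: "bdd_below (range (\<lambda>j. \<bar>X i - Y j\<bar>))" for i
    by (intro bdd_belowI[of _ 0]) auto
  have "(INF j. \<bar>X i - Y j\<bar>) \<le> M" for i
  proof -
    obtain n where "Y n \<le> X i" "X i < Y (n + 1)"
      using point_sets_index[OF Y m] by metis
    hence "\<bar>X i - Y n\<bar> \<le> M" using point_sets_gap(2)[OF Y, of n] by auto
    thus ?thesis by (intro cINF_lower2[OF bdd]) auto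
  qed
  hence "bdd_above (range (\<lambda>i. INF j. \<bar>X i - Y j\<bar>))"
    by (intro bdd_aboveI) auto
  hence "(INF j. \<bar>X i - Y j\<bar>) \<le> (SUP i. INF j. \<bar>X i - Y j\<bar>)"
    by (intro cSUP_upper) auto
  hence "(INF j. \<bar>X i - Y j\<bar>) < r" using less by simp
  thus ?thesis using that by (auto simp: cINF_less_iff[OF _ bdd])
qed

text \<open>Induction along the points. Given that \<open>X i\<close> and \<open>Y i\<close> are close, the point \<open>Y j\<close> near \<open>X (i + 1)\<close> has
\<open>j > i\<close>, and the point \<open>X k\<close> near \<open>Y (i + 1)\<close> has \<open>k > i\<close>. If \<open>j > i + 1\<close>, then \<open>Y (i + 1)\<close> lies more than
\<open>m - r \<ge> r\<close> to the left of \<open>X (i + 1)\<close>, hence of \<open>X k\<close>, a contradiction.\<close>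

lemma enumerations_close:
  assumes X: "X \<in> point_sets m M" and Y: "Y \<in> point_sets m M" and m: "0 < m"
    and dist: "point_dist X Y < r" and r: "0 < r" "2 * r \<le> m"
  shows "\<bar>X (int i) - Y (int i)\<bar> < r"
proof (induction i)
  case 0
  thus ?case using X Y r by (simp add: point_sets_def)
next
  case (Suc i)
  have XY: "(SUP i. INF j. \<bar>X i - Y j\<bar>) < r" "(SUP i. INF j. \<bar>Y i - X j\<bar>) < r"
    using dist by (auto simp: point_dist_def)
  note mono = point_sets_strict_mono[OF X m] point_sets_strict_mono[OF Y m]
  obtain j where j: "\<bar>X (int i + 1) - Y j\<bar> < r"
    using near_point[OF X Y m XY(1)] by blast
  obtain k where k: "\<bar>Y (int i + 1) - X k\<bar> < r"
    using near_point[OF Y X m XY(2)] by blast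
  have "Y (int i) < Y j"
    using j Suc r point_sets_gap(1)[OF X, of "int i"] by linarith
  hence ij: "int i + 1 \<le> j" using strict_mono_less[OF mono(2)] by fastforce
  have "X (int i) < X k"
    using k Suc r point_sets_gap(1)[OF Y, of "int i"] by linarith
  hence "int i + 1 \<le> k" using strict_mono_less[OF mono(1)] by fastforce
  hence Xk: "X (int i + 1) \<le> X k" using strict_mono_less_eq[OF mono(1)] by blast
  have "j = int i + 1"
  proof (rule ccontr)
    assume "j \<noteq> int i + 1"
    hence "Y (int i + 1) + m \<le> Y j" using ij point_sets_less[OF Y m] by simp
    thus False using j k Xk r by linarith
  qed
  thus ?case using j by (simp add: add.commute)
qed

section \<open>Almost periodicity seen on the segments\<close>

lemma PC_shift:
  assumes "p \<in> PC m M"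
  shows "shift p \<tau> \<in> PC m M"
proof (cases p)
  case (fields f V X)
  have X: "X \<in> point_sets m M" and V: "bounded (range V)" and zero: "\<forall>x\<in>range X. f x = 0"
    and f: "bounded (f ` (- range X))"
    and uc: "\<forall>\<epsilon>>0. \<exists>\<delta>>0. \<forall>x y. \<bar>x - y\<bar> < \<delta> \<and> connected_component (- range X) x y \<longrightarrow>
        norm (f x - f y) < \<epsilon>"
    using assms by (auto simp: fields PC_def)
  define Y where "Y = (\<lambda>i. X (i + \<tau>) - X \<tau>)"
  have in_range: "x \<in> range Y \<longleftrightarrow> x + X \<tau> \<in> range X" for x
  proof
    assume "x + X \<tau> \<in> range X"
    then obtain i where "x + X \<tau> = X i" by blast
    hence "x = Y (i - \<tau>)" by (simp add: Y_def)
    thus "x \<in> range Y" by blast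
  qed (auto simp: Y_def)
  have conn: "connected_component (- range X) (x + X \<tau>) (y + X \<tau>)"
    if xy: "connected_component (- range Y) x y" for x y
  proof -
    from xy obtain T where T: "connected T" "T \<subseteq> - range Y" "x \<in> T" "y \<in> T"
      unfolding connected_component_def by blast
    have "connected ((\<lambda>z. z + X \<tau>) ` T)"
      by (intro connected_continuous_image continuous_intros T)
    moreover have "(\<lambda>z. z + X \<tau>) ` T \<subseteq> - range X"
    proof (rule image_subsetI)
      fix z assume "z \<in> T"
      thus "z + X \<tau> \<in> - range X" using T(2) in_range[of z] by auto
    qed
    ultimately show ?thesis
      using T(3,4) unfolding connected_component_def by blast
  qed
  have "bounded ((\<lambda>x. f (x + X \<tau>)) ` (- range Y))"
    by (rule bounded_subset[OF f]) (use in_range in auto)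
  moreover have "bounded (range (\<lambda>i. V (i + \<tau>)))"
    by (rule bounded_subset[OF V]) auto
  moreover have "\<exists>\<delta>>0. \<forall>x y. \<bar>x - y\<bar> < \<delta> \<and> connected_component (- range Y) x y \<longrightarrow>
      norm (f (x + X \<tau>) - f (y + X \<tau>)) < \<epsilon>" if "0 < \<epsilon>" for \<epsilon>
  proof -
    obtain \<delta> where "0 < \<delta>" "\<And>x y. \<bar>x - y\<bar> < \<delta> \<Longrightarrow> connected_component (- range X) x y \<Longrightarrow>
        norm (f x - f y) < \<epsilon>" using uc \<open>0 < \<epsilon>\<close> by blast
    thus ?thesis
      using conn by (intro exI[of _ \<delta>]) auto
  qed
  ultimately show ?thesis
    using point_sets_translate[OF X, of \<tau>] zero
    by (simp add: fields PC_def Y_def)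
qed

text \<open>One modulus of continuity serves all segments: each open segment is connected and free of points of
\<open>\<Gamma>\<close>, so it lies in one component of the complement.\<close>

lemma modulus_on_segments:
  fixes f :: "real \<Rightarrow> 'k::real_normed_field"
  assumes p: "(f, V, X) \<in> PC m M" and m: "0 < m" and "0 < \<epsilon>"
  obtains \<delta> where "0 < \<delta>" "\<And>n x y. x \<in> {X n<..<X (n + 1)} \<Longrightarrow> y \<in> {X n<..<X (n + 1)} \<Longrightarrow>
    \<bar>x - y\<bar> < \<delta> \<Longrightarrow> norm (f x - f y) < \<epsilon>"
proof -
  have X: "X \<in> point_sets m M" using p by (simp add: PC_def)
  from p \<open>0 < \<epsilon>\<close> obtain \<delta> where "0 < \<delta>" and \<delta>: "\<And>x y. \<bar>x - y\<bar> < \<delta> \<Longrightarrow>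
      connected_component (- range X) x y \<Longrightarrow> norm (f x - f y) < \<epsilon>"
    unfolding PC_def by blast
  have "connected_component (- range X) x y"
    if "x \<in> {X n<..<X (n + 1)}" "y \<in> {X n<..<X (n + 1)}" for n x y
  proof -
    have "{X n<..<X (n + 1)} \<subseteq> - range X"
      using point_sets_gap_free[OF X m] by blast
    thus ?thesis unfolding connected_component_def using that connected_Ioo by blast
  qed
  thus ?thesis using that[OF \<open>0 < \<delta>\<close>] \<delta> by blast
qed

lemma fattening_mono: "r \<le> r' \<Longrightarrow> fattening r A \<subseteq> fattening r' A"
  unfolding fattening_def by (auto intro: order_trans)

lemma entourage_S_mono:
  assumes "r \<le> r'"
  shows "entourage_S m M r \<subseteq> (entourage_S m M r' :: ('k::real_normed_field triple \<times> 'k triple) set)"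
proof
  fix pp :: "'k triple \<times> 'k triple"
  assume pp: "pp \<in> entourage_S m M r"
  obtain f1 V1 X1 f2 V2 X2 where eq: "pp = ((f1, V1, X1), (f2, V2, X2))"
    by (metis prod.exhaust)
  have "x \<notin> fattening r (range X1 \<union> range X2)" if "x \<notin> fattening r' (range X1 \<union> range X2)" for x
    using that fattening_mono[OF assms] by blast
  thus "pp \<in> entourage_S m M r'"
    using pp assms unfolding entourage_S_def eq by (auto intro: order.strict_trans2)
qed

text \<open>The centers of a finite net for the nonnegative shifts are again nonnegative shifts.\<close>

lemma shifts_totally_bounded:
  fixes d :: "'k::real_normed_field triple \<Rightarrow> 'k triple \<Rightarrow> real"
  assumes d: "PC_metric m M d" and p: "p \<in> PC_ap m M d" and r: "0 < r"
  obtains T :: "nat set" where "finite T"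
    "\<And>s. \<exists>t\<in>T. (shift p (int s), shift p (int t)) \<in> entourage_S m M r"
proof -
  interpret Metric_space "PC m M" d using d by (simp add: PC_metric_def)
  have pPC: "p \<in> PC m M" and comp: "compactin mtopology (mtopology closure_of range (shift p))"
    using p by (simp_all add: PC_ap_def shift_hull_def)
  obtain n where n: "(1 / 4 :: real) ^ n < r"
    using real_arch_pow_inv[OF r, of "1/4"] by auto
  \<comment> \<open>A ball of radius \<open>1 / 2 ^ Suc N\<close> lies in the entourage number \<open>N\<close>, which is \<open>entourage_S\<close> only for \<open>N \<ge> 1\<close>.\<close>
  define N where "N = Suc n"
  have N: "1 / 4 ^ N < r" "1 \<le> N"
    using n r by (auto simp: N_def power_one_over field_simps intro: order.strict_trans1[rotated])
  have "range (\<lambda>s. shift p (int s)) \<subseteq> range (shift p)" by blast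
  also have "\<dots> \<subseteq> mtopology closure_of range (shift p)"
    using PC_shift[OF pPC] by (intro closure_of_subset) auto
  finally have tb: "mtotally_bounded (range (\<lambda>s. shift p (int s)))"
    using compactin_imp_mtotally_bounded[OF comp] mtotally_bounded_subset by blast
  have radius: "0 < (1 / 2 ^ Suc N :: real)" by simp
  obtain K where K: "finite K" "K \<subseteq> range (\<lambda>s. shift p (int s))"
    "range (\<lambda>s. shift p (int s)) \<subseteq> (\<Union>x\<in>K. mball x (1 / 2 ^ Suc N))"
    using tb[unfolded mtotally_bounded_def, rule_format, OF radius] by metis
  obtain T where T: "finite T" "K = (\<lambda>s. shift p (int s)) ` T"
    using finite_subset_image[OF K(1,2)] by blast
  have "\<exists>t\<in>T. (shift p (int s), shift p (int t)) \<in> entourage_S m M r" for s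
  proof -
    have "shift p (int s) \<in> (\<Union>x\<in>K. mball x (1 / 2 ^ Suc N))"
      by (rule subsetD[OF K(3)]) simp
    then obtain t where t: "t \<in> T" "shift p (int s) \<in> mball (shift p (int t)) (1 / 2 ^ Suc N)"
      unfolding T(2) by blast
    have "{(p, p') \<in> PC m M \<times> PC m M. d p p' < 1 / 2 ^ Suc N} \<subseteq> entourage_U m M (Suc N - 1)"
      by (rule d[unfolded PC_metric_def, THEN conjunct2, rule_format, THEN conjunct2]) simp
    moreover have "d (shift p (int s)) (shift p (int t)) < 1 / 2 ^ Suc N"
      using t(2) by (simp add: commute)
    ultimately have "(shift p (int s), shift p (int t)) \<in> entourage_U m M N"
      using PC_shift[OF pPC] by auto
    hence "(shift p (int s), shift p (int t)) \<in> entourage_S m M (1 / 4 ^ N)"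
      using N(2) by (simp add: entourage_U_def)
    moreover have "entourage_S m M (1 / 4 ^ N) \<subseteq> entourage_S m M r"
      using N(1) by (intro entourage_S_mono) simp
    ultimately show ?thesis using t(1) by blast
  qed
  thus ?thesis using that T(1) by blast
qed

text \<open>The point \<open>u\<close> of the unit interval corresponds to \<open>y\<close> and \<open>z\<close> in the two shifted segments. Near the
ends the entourage gives no information. There, go from \<open>y\<close> to a point \<open>x\<close> at distance at least \<open>3 r\<close>
from both ends, compare the functions at \<open>x\<close>, and go back to \<open>z\<close>; each way has length at most \<open>4 r\<close>.\<close>

lemma segments_close:
  fixes f :: "real \<Rightarrow> 'k::real_normed_field"
  assumes p: "(f, V, X) \<in> PC m M" and m: "0 < m"
    and close: "(shift (f, V, X) (int s), shift (f, V, X) (int t)) \<in> entourage_S m M r"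
    and r: "0 < r" "6 * r \<le> m" "4 * r < \<delta>"
    and \<delta>: "\<And>n x y. x \<in> {X n<..<X (n + 1)} \<Longrightarrow> y \<in> {X n<..<X (n + 1)} \<Longrightarrow>
      \<bar>x - y\<bar> < \<delta> \<Longrightarrow> norm (f x - f y) < \<epsilon>"
  defines "gap \<equiv> \<lambda>n. X (n + 1) - X n"
  shows "\<bar>gap (int (s + n)) - gap (int (t + n))\<bar> \<le> 2 * r"
    and "norm (V (int (s + n)) - V (int (t + n))) \<le> r"
    and "u \<in> {0<..<1} \<Longrightarrow> norm (f (X (int (s + n)) + u * gap (int (s + n))) -
      f (X (int (t + n)) + u * gap (int (t + n)))) \<le> 2 * \<epsilon> + r"
proof -
  have X: "X \<in> point_sets m M" and V: "bounded (range V)" using p by (auto simp: PC_def)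
  define Y Z where "Y = (\<lambda>i. X (i + int s) - X (int s))" and "Z = (\<lambda>i. X (i + int t) - X (int t))"
  have YZ: "Y \<in> point_sets m M" "Z \<in> point_sets m M"
    unfolding Y_def Z_def by (intro point_sets_translate X)+
  have dist: "point_dist Y Z < r"
    and sup: "(SUP i. norm (V (i + int s) - V (i + int t))) < r"
    and away: "\<And>x. x \<notin> fattening r (range Y \<union> range Z) \<Longrightarrow>
      norm (f (x + X (int s)) - f (x + X (int t))) < r"
    using close by (auto simp: entourage_S_def Y_def Z_def)
  have end_close: "\<bar>Y (int i) - Z (int i)\<bar> < r" for i
    by (rule enumerations_close[OF YZ m dist]) (use r m in auto)
  define n' where "n' = int n"
  have near: "\<bar>Y n' - Z n'\<bar> < r" "\<bar>Y (n' + 1) - Z (n' + 1)\<bar> < r"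
    using end_close[of n] end_close[of "Suc n"] by (simp_all add: n'_def add.commute)
  define i j where "i = int (s + n)" and "j = int (t + n)"
  have Xs: "X i = Y n' + X (int s)" "X (i + 1) = Y (n' + 1) + X (int s)"
    "X j = Z n' + X (int t)" "X (j + 1) = Z (n' + 1) + X (int t)"
    by (simp_all add: Y_def Z_def n'_def i_def j_def algebra_simps)
  have gap: "gap i = Y (n' + 1) - Y n'" "gap j = Z (n' + 1) - Z n'"
    by (simp_all add: gap_def Xs)
  show "\<bar>gap (int (s + n)) - gap (int (t + n))\<bar> \<le> 2 * r"
    unfolding i_def[symmetric] j_def[symmetric] gap using near by linarith
  show "norm (V (int (s + n)) - V (int (t + n))) \<le> r"
  proof -
    obtain B where B: "\<And>i. norm (V i) \<le> B" using V by (auto simp: bounded_iff)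
    have "norm (V (i + int s) - V (i + int t)) \<le> B + B" for i
      by (intro norm_triangle_le_diff add_mono B)
    hence "bdd_above (range (\<lambda>i. norm (V (i + int s) - V (i + int t))))"
      by (intro bdd_aboveI[of _ "B + B"]) auto
    hence "norm (V (n' + int s) - V (n' + int t)) \<le> (SUP i. norm (V (i + int s) - V (i + int t)))"
      by (intro cSUP_upper) auto
    thus ?thesis using sup by (simp add: n'_def add.commute)
  qed
  assume u: "u \<in> {0<..<1}"
  define y z where "y = Y n' + u * (Y (n' + 1) - Y n')" and "z = Z n' + u * (Z (n' + 1) - Z n')"
  have gapY: "m \<le> Y (n' + 1) - Y n'" and gapZ: "m \<le> Z (n' + 1) - Z n'"
    using point_sets_gap(1) YZ by blast+
  have u_gap: "0 < u * (Y (n' + 1) - Y n')" "u * (Y (n' + 1) - Y n') < Y (n' + 1) - Y n'"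
    "0 < u * (Z (n' + 1) - Z n')" "u * (Z (n' + 1) - Z n') < Z (n' + 1) - Z n'"
    using u gapY gapZ m by simp_all
  have inside: "Y n' < y" "y < Y (n' + 1)" "Z n' < z" "z < Z (n' + 1)"
    unfolding y_def z_def using u_gap by linarith+
  have "y - z = (1 - u) * (Y n' - Z n') + u * (Y (n' + 1) - Z (n' + 1))"
    by (simp add: y_def z_def algebra_simps)
  also have "\<bar>\<dots>\<bar> \<le> (1 - u) * r + u * r"
    using u near by (intro order_trans[OF abs_triangle_ineq] add_mono)
      (auto simp: abs_mult intro!: mult_left_mono)
  finally have yz: "\<bar>y - z\<bar> \<le> r" by (simp add: algebra_simps)
  \<comment> \<open>\<open>y\<close> moved into the part of the segment at distance at least \<open>3 r\<close> from both ends; \<open>6 * r \<le> m\<close> makes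
that part nonempty.\<close>
  define x where "x = max (Y n' + 3 * r) (min (Y (n' + 1) - 3 * r) y)"
  have x: "Y n' + 3 * r \<le> x" "x \<le> Y (n' + 1) - 3 * r" "\<bar>x - y\<bar> \<le> 3 * r"
    using r gapY inside by (auto simp: x_def max_def min_def abs_le_iff)
  have far: "\<bar>x - W k\<bar> > r" if W: "W \<in> point_sets m M" "\<bar>W n' - Y n'\<bar> < r" "\<bar>W (n' + 1) - Y (n' + 1)\<bar> < r" for W k
  proof (cases "k \<le> n'")
    case True
    hence "W k \<le> W n'" using strict_mono_less_eq[OF point_sets_strict_mono[OF W(1) m]] by blast
    thus ?thesis using W x r by linarith
  next
    case False
    hence "W (n' + 1) \<le> W k" using strict_mono_less_eq[OF point_sets_strict_mono[OF W(1) m]] by auto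
    thus ?thesis using W x r by linarith
  qed
  have "x \<notin> fattening r (range Y \<union> range Z)"
    using far[OF YZ(1)] far[OF YZ(2)] near r by (auto simp: fattening_def not_le)
  from away[OF this] have mid: "norm (f (x + X (int s)) - f (x + X (int t))) < r" .
  have left: "norm (f (y + X (int s)) - f (x + X (int s))) < \<epsilon>"
    using x r inside by (intro \<delta>[of _ i]) (auto simp: Xs abs_minus_commute)
  have right: "norm (f (x + X (int t)) - f (z + X (int t))) < \<epsilon>"
    using x yz r inside near by (intro \<delta>[of _ j]) (auto simp: Xs)
  have "norm (f (y + X (int s)) - f (z + X (int t))) \<le>
      norm (f (y + X (int s)) - f (x + X (int s))) + norm (f (x + X (int s)) - f (x + X (int t))) +
      norm (f (x + X (int t)) - f (z + X (int t)))"
    by (intro norm_diff_triangle_le[OF norm_diff_triangle_le[OF order_refl order_refl] order_refl])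
  also have "\<dots> \<le> \<epsilon> + r + \<epsilon>"
    by (intro add_mono less_imp_le left mid right)
  finally have "norm (f (X i + u * gap i) - f (X j + u * gap j)) \<le> 2 * \<epsilon> + r"
    by (simp add: Xs gap y_def z_def algebra_simps)
  thus "norm (f (X (int (s + n)) + u * gap (int (s + n))) -
      f (X (int (t + n)) + u * gap (int (t + n)))) \<le> 2 * \<epsilon> + r"
    unfolding i_def j_def .
qed

section \<open>Pruefer angles\<close>

text \<open>An orbit of surjections can be continued to negative times by choosing preimages.\<close>

lemma int_indexed_orbit:
  fixes F :: "int \<Rightarrow> 'a \<Rightarrow> 'a"
  assumes surj: "\<And>n. surj (F n)"
  shows "\<exists>\<xi>. \<xi> 0 = x0 \<and> (\<forall>n. \<xi> (n + 1) = F n (\<xi> n))"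
proof -
  define up where "up k = rec_nat x0 (\<lambda>k. F (int k)) k" for k
  define down where "down k = rec_nat x0 (\<lambda>k. inv (F (- int k - 1))) k" for k
  have up: "up 0 = x0" "up (Suc k) = F (int k) (up k)" for k
    by (simp_all add: up_def)
  have down: "down 0 = x0" "down k = F (- int k - 1) (down (Suc k))" for k
    by (simp_all add: down_def surj_f_inv_f[OF surj])
  define \<xi> where "\<xi> n = (if 0 \<le> n then up (nat n) else down (nat (- n)))" for n :: int
  have "\<xi> (n + 1) = F n (\<xi> n)" for n
  proof (cases "0 \<le> n")
    case True
    hence "nat (n + 1) = Suc (nat n)" by simp
    thus ?thesis using True up(2)[of "nat n"] by (simp add: \<xi>_def)
  next
    case False
    define k where "k = nat (- n - 1)"
    have k: "nat (- n) = Suc k" "n = - int k - 1" using False by (auto simp: k_def)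
    have "\<xi> (n + 1) = down k"
      using k up(1) down(1) by (cases "k = 0") (auto simp: \<xi>_def)
    also have "\<dots> = F n (\<xi> n)"
      using down(2)[of k] False k by (simp add: \<xi>_def)
    finally show ?thesis .
  qed
  moreover have "\<xi> 0 = x0" by (simp add: \<xi>_def up)
  ultimately show ?thesis by blast
qed

text \<open>\<open>Q n\<close> is the potential on the segment number \<open>n\<close>, rescaled to the unit interval and extended
continuously to the whole line.\<close>

locale prufer_data =
  fixes m M B W E :: real and q :: "real \<Rightarrow> real" and Q :: "int \<Rightarrow> real \<Rightarrow> real"
    and V X :: "int \<Rightarrow> real"
  assumes m: "0 < m" and X: "X \<in> point_sets m M"
    and Q_continuous: "continuous_on UNIV (Q n)"
    and Q_bound: "\<bar>Q n s\<bar> \<le> B"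
    and Q_eq: "0 < s \<Longrightarrow> s < 1 \<Longrightarrow> Q n s = q (X n + s * (X (n + 1) - X n))"
    and V_bound: "\<bar>V n\<bar> \<le> W"
begin

definition gap :: "int \<Rightarrow> real" where "gap n = X (n + 1) - X n"

definition coef :: "int \<Rightarrow> real \<Rightarrow> real" where "coef n s = gap n * (Q n s - E)"

definition K :: real where "K = M * (1 + B + \<bar>E\<bar>)"

lemma gap: "m \<le> gap n" "gap n \<le> M" "0 < gap n"
  using point_sets_gap[OF X, of n] m by (simp_all add: gap_def)

lemma X_mono: "strict_mono X"
  by (rule point_sets_strict_mono[OF X m])

lemma W_nonneg: "0 \<le> W" and B_nonneg: "0 \<le> B"
  using V_bound[of 0] Q_bound[of 0 0] by linarith+

sublocale segment: angular_coefficients "gap n" "coef n" K for n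
proof
  show "continuous_on UNIV (coef n)"
    unfolding coef_def by (intro continuous_intros Q_continuous)
  fix t
  have "\<bar>gap n\<bar> + \<bar>coef n t\<bar> = gap n * (1 + \<bar>Q n t - E\<bar>)"
    using gap(3)[of n] by (simp add: coef_def abs_mult distrib_left)
  also have "\<dots> \<le> M * (1 + B + \<bar>E\<bar>)"
    using gap[of n] Q_bound[of n t] by (intro mult_mono) auto
  finally show "\<bar>gap n\<bar> + \<bar>coef n t\<bar> \<le> K" by (simp add: K_def)
qed

sublocale jump: angular_coefficients 0 "\<lambda>_. V n" W for n
  by unfold_locales (auto simp: V_bound)

text \<open>The jump at \<open>X (n + 1)\<close> belongs to step \<open>n\<close>, since a Pruefer angle is right-continuous: its value at
\<open>X n\<close> already includes the jump there.\<close>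

definition step :: "int \<Rightarrow> real \<Rightarrow> real" where
  "step n \<xi> = angular_flow 0 (\<lambda>_. V (n + 1)) (angular_flow (gap n) (coef n) \<xi> 1) 1"

lemma step_mono: "\<xi> \<le> \<xi>' \<Longrightarrow> step n \<xi> \<le> step n \<xi>'"
  unfolding step_def by (intro segment.flow_mono jump.flow_mono) auto

lemma step_inj: "step n \<xi> = step n \<xi>' \<Longrightarrow> \<xi> = \<xi>'"
  unfolding step_def by (blast dest: segment.flow_inj jump.flow_inj)

lemma step_surj: "surj (step n)"
  unfolding surj_def
proof
  fix \<eta>
  obtain \<xi>1 where "angular_flow 0 (\<lambda>_. V (n + 1)) \<xi>1 1 = \<eta>" using jump.flow_surj .
  moreover obtain \<xi> where "angular_flow (gap n) (coef n) \<xi> 1 = \<xi>1" using segment.flow_surj .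
  ultimately show "\<exists>\<xi>. \<eta> = step n \<xi>" unfolding step_def by blast
qed

lemma step_periodic: "step n (\<xi> + pi) = step n \<xi> + pi"
  by (simp add: step_def segment.flow_periodic jump.flow_periodic)

lemma step_displacement: "\<bar>step n \<xi> - \<xi>\<bar> \<le> K + W"
  using segment.flow_displacement[of 1 n \<xi>]
    jump.flow_displacement[of 1 "n + 1" "angular_flow (gap n) (coef n) \<xi> 1"]
  unfolding step_def by linarith

lemma step_compare:
  assumes "\<bar>gap i - gap j\<bar> \<le> \<eta>" "\<bar>V (i + 1) - V (j + 1)\<bar> \<le> \<eta>"
    and Q: "\<And>s. 0 < s \<Longrightarrow> s < 1 \<Longrightarrow> \<bar>Q i s - Q j s\<bar> \<le> \<eta>"
  shows "\<bar>step i \<xi> - step j \<xi>'\<bar> \<le>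
    ((\<bar>\<xi> - \<xi>'\<bar> + (1 + M + B + \<bar>E\<bar>) * \<eta>) * exp K + \<eta>) * exp W"
proof -
  have \<eta>: "0 \<le> \<eta>" using assms(1) by linarith
  have "0 \<le> M" using gap[of 0] by linarith
  have "\<bar>gap i - gap j\<bar> + \<bar>coef i s - coef j s\<bar> \<le> (1 + M + B + \<bar>E\<bar>) * \<eta>" if s: "0 < s" "s < 1" for s
  proof -
    have "coef i s - coef j s = gap i * (Q i s - Q j s) + (Q j s - E) * (gap i - gap j)"
      by (simp add: coef_def algebra_simps)
    also have "\<bar>\<dots>\<bar> \<le> \<bar>gap i\<bar> * \<bar>Q i s - Q j s\<bar> + \<bar>Q j s - E\<bar> * \<bar>gap i - gap j\<bar>"
      by (metis abs_mult abs_triangle_ineq)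
    also have "\<dots> \<le> M * \<eta> + (B + \<bar>E\<bar>) * \<eta>"
      using gap[of i] Q_bound[of j s] \<open>0 \<le> M\<close> B_nonneg
      by (intro add_mono mult_mono assms(1) Q s) auto
    finally show ?thesis using assms(1) by (simp add: algebra_simps)
  qed
  hence segment: "\<bar>angular_flow (gap i) (coef i) \<xi> 1 - angular_flow (gap j) (coef j) \<xi>' 1\<bar> \<le>
      (\<bar>\<xi> - \<xi>'\<bar> + (1 + M + B + \<bar>E\<bar>) * \<eta>) * exp K"
    using \<eta> \<open>0 \<le> M\<close> B_nonneg
    by (intro segment.flow_compare[OF segment.angular_coefficients_axioms]) auto
  have "\<bar>step i \<xi> - step j \<xi>'\<bar> \<le> (\<bar>angular_flow (gap i) (coef i) \<xi> 1 -
      angular_flow (gap j) (coef j) \<xi>' 1\<bar> + \<eta>) * exp W"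
    unfolding step_def using assms(2) \<eta>
    by (intro jump.flow_compare[OF jump.angular_coefficients_axioms]) auto
  also have "\<dots> \<le> ((\<bar>\<xi> - \<xi>'\<bar> + (1 + M + B + \<bar>E\<bar>) * \<eta>) * exp K + \<eta>) * exp W"
    by (intro mult_right_mono add_right_mono segment) auto
  finally show ?thesis .
qed

lemma step_lipschitz: "\<bar>step n \<xi> - step n \<xi>'\<bar> \<le> exp (K + W) * \<bar>\<xi> - \<xi>'\<bar>"
  using step_compare[of n n 0 \<xi> \<xi>'] by (simp add: exp_add mult_ac)

lemma rhs_on_segment:
  assumes "0 < s" "s < 1"
  shows "angular_rhs (gap n) (coef n s) y =
    gap n * ((cos y)\<^sup>2 - (q (X n + s * gap n) - E) * (sin y)\<^sup>2)"
  using Q_eq[OF assms, of n] by (simp add: angular_rhs_def coef_def gap_def algebra_simps)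

text \<open>Completed by its left limit at the right end, a Pruefer angle is on each rescaled segment the solution
of the angular equation.\<close>

lemma solution_on_segment:
  assumes sol: "prufer_solution E (q, V, X) \<Xi> \<theta>"
  shows "0 \<le> s \<Longrightarrow> s < 1 \<Longrightarrow> \<theta> (X n + s * gap n) = angular_flow (gap n) (coef n) (\<theta> (X n)) s"
    and "\<theta> (X (n + 1)) = step n (\<theta> (X n))"
proof -
  obtain l where l: "(\<theta> \<longlongrightarrow> l) (at_left (X (n + 1)))" "\<theta> (X (n + 1)) - l = angle_J (V (n + 1)) l"
    using sol unfolding prufer_solution.simps by blast
  define \<phi> where "\<phi> s = X n + s * gap n" for s
  \<comment> \<open>The value at \<open>s = 1\<close> is the left limit, the angle before the jump.\<close>
  define y where "y s = (if s < 1 then \<theta> (\<phi> s) else l)" for s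
  have g: "0 < gap n" by (rule gap)
  have dy: "(y has_real_derivative angular_rhs (gap n) (coef n s) (y s)) (at s)"
    if s: "0 < s" "s < 1" for s
  proof -
    have in_seg: "X n < \<phi> s" "\<phi> s < X (n + 1)"
    proof -
      have "s * gap n < gap n" using s g by simp
      thus "\<phi> s < X (n + 1)" by (simp add: \<phi>_def gap_def)
    qed (use s g in \<open>simp add: \<phi>_def\<close>)
    have "(\<theta> has_real_derivative (cos (\<theta> (\<phi> s)))\<^sup>2 - (q (\<phi> s) - E) * (sin (\<theta> (\<phi> s)))\<^sup>2) (at (\<phi> s))"
      using sol point_sets_gap_free[OF X m, of _ n] in_seg by simp
    moreover have "(\<phi> has_real_derivative gap n) (at s)"
      unfolding \<phi>_def by (auto intro!: derivative_eq_intros)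
    ultimately have "((\<lambda>s. \<theta> (\<phi> s)) has_real_derivative
        ((cos (\<theta> (\<phi> s)))\<^sup>2 - (q (\<phi> s) - E) * (sin (\<theta> (\<phi> s)))\<^sup>2) * gap n) (at s)"
      by (rule DERIV_chain2)
    hence "((\<lambda>s. \<theta> (\<phi> s)) has_real_derivative angular_rhs (gap n) (coef n s) (y s)) (at s)"
      using s by (simp add: rhs_on_segment y_def mult.commute flip: \<phi>_def)
    thus ?thesis
      by (rule has_field_derivative_transform_within_open[where S = "{..<1}"])
         (use s in \<open>auto simp: y_def\<close>)
  qed
  have "continuous_on {0..1} y"
  proof (rule continuous_on_IccI)
    have "filterlim \<phi> (at_right (X n)) (at_right 0)"
      unfolding filterlim_at
    proof
      show "\<forall>\<^sub>F s in at_right 0. \<phi> s \<in> {X n<..} \<and> \<phi> s \<noteq> X n"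
        using g by (auto simp: \<phi>_def eventually_at_right_less eventually_at_filter)
      have "(\<phi> \<longlongrightarrow> \<phi> 0) (at_right 0)"
        unfolding \<phi>_def by (intro tendsto_intros)
      thus "filterlim \<phi> (nhds (X n)) (at_right 0)" by (simp add: \<phi>_def)
    qed
    moreover have "(\<theta> \<longlongrightarrow> \<theta> (X n)) (at_right (X n))"
      using sol by (simp add: continuous_within)
    ultimately have "((\<lambda>s. \<theta> (\<phi> s)) \<longlongrightarrow> \<theta> (X n)) (at_right 0)"
      by (rule filterlim_compose[rotated])
    moreover have "\<forall>\<^sub>F s in at_right 0. \<theta> (\<phi> s) = y s"
      unfolding eventually_at_right_field by (intro exI[of _ 1]) (auto simp: y_def)
    ultimately have "(y \<longlongrightarrow> \<theta> (X n)) (at_right 0)"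
      by (rule Lim_transform_eventually)
    thus "(y \<longlongrightarrow> y 0) (at_right 0)" by (simp add: y_def \<phi>_def)
    have "filterlim \<phi> (at_left (X (n + 1))) (at_left 1)"
      unfolding filterlim_at
    proof
      show "\<forall>\<^sub>F s in at_left 1. \<phi> s \<in> {..<X (n + 1)} \<and> \<phi> s \<noteq> X (n + 1)"
        unfolding eventually_at_left_field
      proof (intro exI[of _ 0] conjI allI impI)
        fix s :: real assume "0 < s" "s < 1"
        hence "s * gap n < gap n" using g by simp
        thus "\<phi> s \<in> {..<X (n + 1)}" "\<phi> s \<noteq> X (n + 1)" by (simp_all add: \<phi>_def gap_def)
      qed simp
      have "(\<phi> \<longlongrightarrow> \<phi> 1) (at_left 1)"
        unfolding \<phi>_def by (intro tendsto_intros)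
      thus "filterlim \<phi> (nhds (X (n + 1))) (at_left 1)" by (simp add: \<phi>_def gap_def)
    qed
    with l(1) have "((\<lambda>s. \<theta> (\<phi> s)) \<longlongrightarrow> l) (at_left 1)"
      by (rule filterlim_compose)
    moreover have "\<forall>\<^sub>F s in at_left 1. \<theta> (\<phi> s) = y s"
      unfolding eventually_at_filter by (intro always_eventually) (auto simp: y_def)
    ultimately have "(y \<longlongrightarrow> l) (at_left 1)"
      by (rule Lim_transform_eventually)
    thus "(y \<longlongrightarrow> y 1) (at_left 1)" by (simp add: y_def)
    show "(y \<longlongrightarrow> y s) (at s)" if "0 < s" "s < 1" for s
      using DERIV_isCont[OF dy[OF that]] by (simp add: isCont_def)
  qed simp
  from segment.flow_unique_on_segment[OF this dy]
  have y: "y s = angular_flow (gap n) (coef n) (y 0) s" if "0 \<le> s" "s \<le> 1" for s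
    using that by blast
  have y0: "y 0 = \<theta> (X n)" by (simp add: y_def \<phi>_def)
  show "\<theta> (X n + s * gap n) = angular_flow (gap n) (coef n) (\<theta> (X n)) s" if "0 \<le> s" "s < 1"
    using y[of s] that y0 by (simp add: y_def \<phi>_def)
  have "l = angular_flow (gap n) (coef n) (\<theta> (X n)) 1"
    using y[of 1] y0 by (simp add: y_def)
  thus "\<theta> (X (n + 1)) = step n (\<theta> (X n))"
    using l(2) angle_J_eq_flow[of l "V (n + 1)"] by (simp add: step_def)
qed

definition index :: "real \<Rightarrow> int" where
  "index x = (THE n. X n \<le> x \<and> x < X (n + 1))"

lemma index: "X (index x) \<le> x" "x < X (index x + 1)"
  using theI'[OF point_sets_index[OF X m, of x]] by (simp_all add: index_def)

lemma index_eqI: "X n \<le> x \<Longrightarrow> x < X (n + 1) \<Longrightarrow> index x = n"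
  using point_sets_index[OF X m, of x] index by blast

definition local_time :: "real \<Rightarrow> real" where
  "local_time x = (x - X (index x)) / gap (index x)"

lemma local_time: "0 \<le> local_time x" "local_time x < 1" "x = X (index x) + local_time x * gap (index x)"
  using index[of x] gap(3)[of "index x"] by (auto simp: local_time_def gap_def field_simps)

lemma solution_unique:
  assumes sol: "prufer_solution E (q, V, X) \<Xi> \<theta>" "prufer_solution E (q, V, X) \<Xi> \<theta>'"
  shows "\<theta> = \<theta>'"
proof (rule ext)
  have X0: "X 0 = 0" using X by (simp add: point_sets_def)
  have points: "\<theta> (X n) = \<theta>' (X n)" for n
  proof (induction n rule: int_induct[where k = 0])
    case base
    thus ?case using sol X0 by simp
  next
    case (step1 i)
    thus ?case using solution_on_segment(2)[OF sol(1), of i] solution_on_segment(2)[OF sol(2), of i]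
      by simp
  next
    case (step2 i)
    thus ?case
      using solution_on_segment(2)[OF sol(1), of "i - 1"] solution_on_segment(2)[OF sol(2), of "i - 1"]
      by (auto intro: step_inj)
  qed
  fix x
  show "\<theta> x = \<theta>' x"
    using solution_on_segment(1)[OF sol(1), where s = "local_time x" and n = "index x"]
      solution_on_segment(1)[OF sol(2), where s = "local_time x" and n = "index x"] points
      local_time(1,2)[of x]
    by (simp flip: local_time(3))
qed

lemma solution_exists: "\<exists>\<theta>. prufer_solution E (q, V, X) \<Xi> \<theta>"
proof -
  obtain \<xi> where \<xi>0: "\<xi> 0 = \<Xi>" and \<xi>: "\<And>n. \<xi> (n + 1) = step n (\<xi> n)"
    using int_indexed_orbit[of step \<Xi>] step_surj by blast
  have X0: "X 0 = 0" using X by (simp add: point_sets_def)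
  define \<psi> where "\<psi> n x = angular_flow (gap n) (coef n) (\<xi> n) ((x - X n) / gap n)" for n x
  define \<theta> where "\<theta> x = \<psi> (index x) x" for x
  have \<theta>: "\<theta> x = \<psi> n x" if "X n \<le> x" "x < X (n + 1)" for n x
    using index_eqI[OF that] by (simp add: \<theta>_def)
  have d\<psi>: "(\<psi> n has_real_derivative
      angular_rhs (gap n) (coef n ((x - X n) / gap n)) (\<psi> n x) / gap n) (at x)" for n x
  proof -
    have "((\<lambda>x. (x - X n) / gap n) has_real_derivative 1 / gap n) (at x)"
      using gap(3)[of n] by (auto intro!: derivative_eq_intros)
    from DERIV_chain2[OF segment.flow_deriv this] show ?thesis
      by (simp add: \<psi>_def[abs_def])
  qed
  have cont: "isCont (\<psi> n) x" for n x
    by (rule DERIV_isCont[OF d\<psi>])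
  have next_point: "X n < X (n + 1)" for n
    using gap(3)[of n] by (simp add: gap_def)
  have "prufer_solution E (q, V, X) \<Xi> \<theta>"
    unfolding prufer_solution.simps
  proof (intro conjI allI impI)
    show "\<theta> 0 = \<Xi>"
      using \<theta>[of 0 0] next_point[of 0] X0 \<xi>0 by (simp add: \<psi>_def segment.flow)
  next
    fix x
    have "\<forall>\<^sub>F z in at_right x. \<psi> (index x) z = \<theta> z"
      unfolding eventually_at_right_field
      using index[of x] by (intro exI[of _ "X (index x + 1)"]) (auto intro!: \<theta>[symmetric])
    moreover have "(\<psi> (index x) \<longlongrightarrow> \<psi> (index x) x) (at_right x)"
      using cont[of x "index x"] by (simp add: isCont_def filterlim_at_split)
    ultimately have "(\<theta> \<longlongrightarrow> \<psi> (index x) x) (at_right x)"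
      by (rule Lim_transform_eventually[rotated])
    thus "continuous (at_right x) \<theta>"
      by (simp add: continuous_within \<theta>_def)
  next
    fix x assume "x \<notin> range X"
    define n where "n = index x"
    have "X n \<noteq> x" using \<open>x \<notin> range X\<close> by blast
    hence n: "X n < x" "x < X (n + 1)"
      using index[of x] unfolding n_def by linarith+
    define s where "s = (x - X n) / gap n"
    have s: "0 < s" "s < 1" "X n + s * gap n = x"
      using n gap(3)[of n] by (auto simp: s_def gap_def field_simps)
    have "\<psi> n x = \<theta> x" using \<theta>[OF less_imp_le] n by simp
    have "(\<psi> n has_real_derivative
        gap n * ((cos (\<theta> x))\<^sup>2 - (q x - E) * (sin (\<theta> x))\<^sup>2) / gap n) (at x)"
      using d\<psi>[of n x] rhs_on_segment[OF s(1,2), of n "\<psi> n x"] \<open>\<psi> n x = \<theta> x\<close> s(3)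
      by (simp flip: s_def)
    hence "(\<psi> n has_real_derivative (cos (\<theta> x))\<^sup>2 - (q x - E) * (sin (\<theta> x))\<^sup>2) (at x)"
      using gap(3)[of n] by simp
    thus "(\<theta> has_real_derivative (cos (\<theta> x))\<^sup>2 - (q x - E) * (sin (\<theta> x))\<^sup>2) (at x)"
      by (rule has_field_derivative_transform_within_open[where S = "{X n<..<X (n + 1)}"])
         (use n in \<open>auto intro!: \<theta>[symmetric]\<close>)
  next
    fix n :: int
    define k where "k = n - 1"
    have k: "X (k + 1) = X n" "X k < X n" using next_point[of k] by (simp_all add: k_def)
    have "\<forall>\<^sub>F z in at_left (X n). \<psi> k z = \<theta> z"
      unfolding eventually_at_left_field
      using k by (intro exI[of _ "X k"]) (auto intro!: \<theta>[symmetric])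
    moreover have "(\<psi> k \<longlongrightarrow> \<psi> k (X n)) (at_left (X n))"
      using cont[of "X n" k] by (simp add: isCont_def filterlim_at_split)
    ultimately have left: "(\<theta> \<longlongrightarrow> \<psi> k (X n)) (at_left (X n))"
      by (rule Lim_transform_eventually[rotated])
    have "\<psi> k (X n) = angular_flow (gap k) (coef k) (\<xi> k) 1"
      using gap(3)[of k] k(1) by (simp add: \<psi>_def gap_def)
    hence "step k (\<xi> k) = \<psi> k (X n) + angle_J (V n) (\<psi> k (X n))"
      by (simp add: step_def angle_J_eq_flow k_def)
    moreover have "\<theta> (X n) = \<xi> n"
      using \<theta>[of n "X n"] next_point[of n] by (simp add: \<psi>_def segment.flow)
    moreover have "\<xi> n = step k (\<xi> k)" using \<xi>[of k] by (simp add: k_def)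
    ultimately show "\<exists>l. (\<theta> \<longlongrightarrow> l) (at_left (X n)) \<and> \<theta> (X n) - l = angle_J (V n) l"
      using left by (intro exI[of _ "\<psi> k (X n)"]) simp
  qed
  thus ?thesis by blast
qed

lemma prufer_angle: "prufer_solution E (q, V, X) \<Xi> (prufer_angle E (q, V, X) \<Xi>)"
  unfolding prufer_angle_def using solution_exists solution_unique by (metis (no_types) theI')

lemma prufer_angle_points:
  "prufer_angle E (q, V, X) \<Xi> (X (int N)) = orbit (\<lambda>n. step (int n)) 0 N \<Xi>"
proof (induction N)
  case 0
  show ?case using prufer_angle[of \<Xi>] X by (simp add: point_sets_def)
next
  case (Suc N)
  thus ?case using solution_on_segment(2)[OF prufer_angle, of \<Xi> "int N"] by (simp add: add.commute)
qed

lemma prufer_angle_between: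
  "\<bar>prufer_angle E (q, V, X) \<Xi> x - prufer_angle E (q, V, X) \<Xi> (X (index x))\<bar> \<le> K"
  using solution_on_segment(1)[OF prufer_angle[of \<Xi>], where s = "local_time x" and n = "index x"]
    segment.flow_displacement[of "local_time x" "index x"] local_time[of x]
  by simp

end

section \<open>The rotation number\<close>

text \<open>The form in which almost periodicity is used: finitely many tails of the sequence of segments
approximate all of them, uniformly in the later segments.\<close>

locale almost_periodic_prufer_data = prufer_data +
  assumes recurrence: "0 < \<eta> \<Longrightarrow> \<exists>T. finite T \<and> (\<forall>s::nat. \<exists>t\<in>T. \<forall>n.
      \<bar>gap (int (s + n)) - gap (int (t + n))\<bar> \<le> \<eta> \<and>
      \<bar>V (int (s + n)) - V (int (t + n))\<bar> \<le> \<eta> \<and>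
      (\<forall>u\<in>{0<..<1}. \<bar>Q (int (s + n)) u - Q (int (t + n)) u\<bar> \<le> \<eta>))"
begin

sublocale steps: circle_lifts "\<lambda>n. step (int n)" "K + W" "exp (K + W)"
proof
  show "1 \<le> exp (K + W)" using segment.K_nonneg W_nonneg by simp
  fix \<epsilon> :: real assume "0 < \<epsilon>"
  define c where "c = ((1 + M + B + \<bar>E\<bar>) * exp K + 1) * exp W"
  have "0 \<le> (1 + M + B + \<bar>E\<bar>) * exp K"
    using gap[of 0] B_nonneg by (intro mult_nonneg_nonneg) auto
  hence c: "0 < c" by (simp add: c_def add_nonneg_pos)
  hence \<eta>: "0 < \<epsilon> / c" using \<open>0 < \<epsilon>\<close> by simp
  obtain T where T: "finite T" "\<And>s. \<exists>t\<in>T. \<forall>n.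
      \<bar>gap (int (s + n)) - gap (int (t + n))\<bar> \<le> \<epsilon> / c \<and>
      \<bar>V (int (s + n)) - V (int (t + n))\<bar> \<le> \<epsilon> / c \<and>
      (\<forall>u\<in>{0<..<1}. \<bar>Q (int (s + n)) u - Q (int (t + n)) u\<bar> \<le> \<epsilon> / c)"
    using recurrence[OF \<eta>] by blast
  have total: "((\<bar>x - x\<bar> + (1 + M + B + \<bar>E\<bar>) * e) * exp K + e) * exp W = c * e" for x e :: real
    by (simp add: c_def algebra_simps)
  have "\<exists>t\<in>T. \<forall>n x. \<bar>step (int (s + n)) x - step (int (t + n)) x\<bar> \<le> \<epsilon>" for s
  proof -
    obtain t where "t \<in> T" and t: "\<And>n. \<bar>gap (int (s + n)) - gap (int (t + n))\<bar> \<le> \<epsilon> / c"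
      "\<And>n. \<bar>V (int (s + n)) - V (int (t + n))\<bar> \<le> \<epsilon> / c"
      "\<And>n u. 0 < u \<Longrightarrow> u < 1 \<Longrightarrow> \<bar>Q (int (s + n)) u - Q (int (t + n)) u\<bar> \<le> \<epsilon> / c"
      using T(2)[of s] by (metis greaterThanLessThan_iff)
    have "\<bar>step (int (s + n)) x - step (int (t + n)) x\<bar> \<le> \<epsilon>" for n x
    proof -
      have "\<bar>V (int (s + n) + 1) - V (int (t + n) + 1)\<bar> \<le> \<epsilon> / c"
        using t(2)[of "Suc n"] by (simp add: add_ac)
      from step_compare[OF t(1) this t(3), of x x]
      have "\<bar>step (int (s + n)) x - step (int (t + n)) x\<bar> \<le> c * (\<epsilon> / c)"
        unfolding total by blast
      thus ?thesis using c by simp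
    qed
    thus ?thesis using \<open>t \<in> T\<close> by blast
  qed
  thus "\<exists>T. finite T \<and> (\<forall>s. \<exists>t\<in>T. \<forall>n x.
      \<bar>step (int (s + n)) x - step (int (t + n)) x\<bar> \<le> \<epsilon>)"
    using T(1) by blast
qed (use step_mono step_periodic step_displacement step_lipschitz in auto)

sublocale gaps: circle_lifts "\<lambda>n x. x + gap (int n)" M 1
proof
  fix \<epsilon> :: real assume "0 < \<epsilon>"
  from recurrence[OF this] show "\<exists>T. finite T \<and> (\<forall>s. \<exists>t\<in>T. \<forall>n x.
      \<bar>x + gap (int (s + n)) - (x + gap (int (t + n)))\<bar> \<le> \<epsilon>)"
    by (simp add: Ball_def Bex_def) meson
qed (use gap in \<open>auto simp: abs_of_pos\<close>)

lemma X_eq_orbit: "X (int N) = orbit (\<lambda>n x. x + gap (int n)) 0 N 0"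
proof (induction N)
  case 0
  show ?case using X by (simp add: point_sets_def)
next
  case (Suc N)
  have "X (int (Suc N)) = X (int N) + gap (int N)" by (simp add: gap_def add.commute)
  thus ?case using Suc by simp
qed

lemma X_lower: "m * real N \<le> X (int N)"
  using point_sets_growth(1)[OF X, of 0 "int N"] X by (simp add: point_sets_def)

text \<open>Numerator and denominator have a mean growth per step, and the one of the denominator is at least \<open>m\<close>.\<close>

lemma rotation_number_points:
  "\<exists>\<rho>. \<forall>\<Xi>. (\<lambda>N. (prufer_angle E (q, V, X) \<Xi> (X (int N)) - \<Xi>) / X (int N)) \<longlonglongrightarrow> \<rho>"
proof -
  obtain \<alpha> where \<alpha>: "\<And>\<Xi>. (\<lambda>N. (orbit (\<lambda>n. step (int n)) 0 N \<Xi> - \<Xi>) / real N) \<longlonglongrightarrow> \<alpha>"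
    using steps.orbit_rate_convergent by blast
  obtain D where "(\<lambda>N. (orbit (\<lambda>n x. x + gap (int n)) 0 N 0 - 0) / real N) \<longlonglongrightarrow> D"
    using gaps.orbit_rate_convergent by blast
  hence D: "(\<lambda>N. X (int N) / real N) \<longlonglongrightarrow> D" by (simp add: X_eq_orbit)
  have "m \<le> D"
  proof (rule tendsto_lowerbound[OF D])
    show "\<forall>\<^sub>F N in sequentially. m \<le> X (int N) / real N"
      using eventually_gt_at_top[of 0] by eventually_elim (use X_lower in \<open>simp add: field_simps\<close>)
  qed simp
  have "(\<lambda>N. (prufer_angle E (q, V, X) \<Xi> (X (int N)) - \<Xi>) / X (int N)) \<longlonglongrightarrow> \<alpha> / D" for \<Xi>
  proof -
    have "(\<lambda>N. (prufer_angle E (q, V, X) \<Xi> (X (int N)) - \<Xi>) / real N / (X (int N) / real N))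
        \<longlonglongrightarrow> \<alpha> / D"
      unfolding prufer_angle_points using \<open>m \<le> D\<close> m by (intro tendsto_divide \<alpha> D) auto
    moreover have "\<forall>\<^sub>F N in sequentially.
        (prufer_angle E (q, V, X) \<Xi> (X (int N)) - \<Xi>) / real N / (X (int N) / real N) =
        (prufer_angle E (q, V, X) \<Xi> (X (int N)) - \<Xi>) / X (int N)"
      using eventually_gt_at_top[of 0] by eventually_elim simp
    ultimately show ?thesis by (rule Lim_transform_eventually)
  qed
  thus ?thesis by blast
qed

lemma filterlim_index: "filterlim index at_top at_top"
  unfolding filterlim_at_top
proof
  fix Z
  show "\<forall>\<^sub>F x in at_top. Z \<le> index x"
    using eventually_ge_at_top[of "X Z"]
  proof eventually_elim
    case (elim x)
    hence "X Z < X (index x + 1)" using index(2)[of x] by linarith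
    thus ?case using strict_mono_less[OF X_mono] by fastforce
  qed
qed

text \<open>Between consecutive points both the angle and \<open>x\<close> change by a bounded amount, so the limit along the
points is the limit along all \<open>x\<close>.\<close>

theorem rotation_number:
  "\<exists>\<rho>. \<forall>\<Xi>.
    ((\<lambda>n. (prufer_angle E (q, V, X) \<Xi> (X n) - \<Xi>) / X n) \<longlongrightarrow> \<rho>) at_top \<and>
    ((\<lambda>x. (prufer_angle E (q, V, X) \<Xi> x - \<Xi>) / x) \<longlongrightarrow> \<rho>) at_top"
proof -
  obtain \<rho> where \<rho>: "\<And>\<Xi>. (\<lambda>N. (prufer_angle E (q, V, X) \<Xi> (X (int N)) - \<Xi>) / X (int N)) \<longlonglongrightarrow> \<rho>"
    using rotation_number_points by blast
  have "((\<lambda>n. (prufer_angle E (q, V, X) \<Xi> (X n) - \<Xi>) / X n) \<longlongrightarrow> \<rho>) at_top \<and>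
    ((\<lambda>x. (prufer_angle E (q, V, X) \<Xi> x - \<Xi>) / x) \<longlongrightarrow> \<rho>) at_top" for \<Xi>
  proof
    define \<theta> where "\<theta> = prufer_angle E (q, V, X) \<Xi>"
    define R where "R n = (\<theta> (X n) - \<Xi>) / X n" for n
    have "((\<lambda>n. R (int (nat n))) \<longlongrightarrow> \<rho>) at_top"
      using filterlim_compose[OF \<rho> filterlim_nat_sequentially] by (simp add: R_def \<theta>_def)
    moreover have "\<forall>\<^sub>F n::int in at_top. R (int (nat n)) = R n"
      using eventually_ge_at_top[of 0] by eventually_elim simp
    ultimately have R: "(R \<longlongrightarrow> \<rho>) at_top" by (rule Lim_transform_eventually)
    thus "((\<lambda>n. (prufer_angle E (q, V, X) \<Xi> (X n) - \<Xi>) / X n) \<longlongrightarrow> \<rho>) at_top"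
      by (simp add: R_def[abs_def] \<theta>_def)
    have small: "((\<lambda>x. c x / x) \<longlongrightarrow> 0) at_top" if c: "\<And>x. \<bar>c x\<bar> \<le> C" for c :: "real \<Rightarrow> real" and C
    proof (rule Lim_null_comparison)
      show "\<forall>\<^sub>F x in at_top. norm (c x / x) \<le> C / x"
        using eventually_gt_at_top[of 0] by eventually_elim (use c in \<open>simp add: divide_right_mono\<close>)
      show "((\<lambda>x. C / x) \<longlongrightarrow> 0) at_top"
        by (rule real_tendsto_divide_at_top[OF tendsto_const filterlim_ident])
    qed
    have "\<bar>x - X (index x)\<bar> \<le> M" for x
      using index[of x] gap(2)[of "index x"] by (simp add: gap_def)
    hence "((\<lambda>x. 1 - (x - X (index x)) / x) \<longlongrightarrow> 1 - 0) at_top"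
      by (intro tendsto_diff tendsto_const small)
    moreover have "((\<lambda>x. R (index x)) \<longlongrightarrow> \<rho>) at_top"
      by (rule filterlim_compose[OF R filterlim_index])
    moreover have "((\<lambda>x. (\<theta> x - \<theta> (X (index x))) / x) \<longlongrightarrow> 0) at_top"
      unfolding \<theta>_def by (rule small[OF prufer_angle_between])
    ultimately have "((\<lambda>x. R (index x) * (1 - (x - X (index x)) / x) + (\<theta> x - \<theta> (X (index x))) / x)
        \<longlongrightarrow> \<rho> * (1 - 0) + 0) at_top"
      by (intro tendsto_add tendsto_mult)
    moreover have "\<forall>\<^sub>F x in at_top. R (index x) * (1 - (x - X (index x)) / x) +
        (\<theta> x - \<theta> (X (index x))) / x = (\<theta> x - \<Xi>) / x"
      using eventually_gt_at_top[of "X 1"]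
    proof eventually_elim
      case (elim x)
      have "X 0 = 0" using X by (simp add: point_sets_def)
      have "X 1 < X (index x + 1)" using elim index(2)[of x] by linarith
      hence "X 0 < X (index x)" using strict_mono_less[OF X_mono] by auto
      hence "0 < X (index x)" "0 < x" using \<open>X 0 = 0\<close> index(1)[of x] by auto
      hence "R (index x) * (1 - (x - X (index x)) / x) = (\<theta> (X (index x)) - \<Xi>) / x"
        by (simp add: R_def field_simps)
      thus ?case by (simp flip: add_divide_distrib)
    qed
    ultimately show "((\<lambda>x. (prufer_angle E (q, V, X) \<Xi> x - \<Xi>) / x) \<longlongrightarrow> \<rho>) at_top"
      unfolding \<theta>_def by (simp add: Lim_transform_eventually)
  qed
  thus ?thesis by blast
qed

end

text \<open>Truncation at \<open>- B\<close> and \<open>B\<close> keeps the bound for the extension.\<close>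

lemma continuous_extension_of_open_unit_interval:
  fixes h :: "real \<Rightarrow> real"
  assumes uc: "uniformly_continuous_on {0<..<1} h"
    and bound: "\<And>s. 0 < s \<Longrightarrow> s < 1 \<Longrightarrow> \<bar>h s\<bar> \<le> B" and "0 \<le> B"
  shows "\<exists>Q. continuous_on UNIV Q \<and> (\<forall>s. \<bar>Q s\<bar> \<le> B) \<and> (\<forall>s. 0 < s \<longrightarrow> s < 1 \<longrightarrow> Q s = h s)"
proof -
  obtain g where g: "uniformly_continuous_on (closure {0<..<1}) g" "\<And>s. s \<in> {0<..<1} \<Longrightarrow> h s = g s"
    using uniformly_continuous_on_extension_on_closure[OF uc] by metis
  have g_cont: "continuous_on {0..1} g"
    using uniformly_continuous_imp_continuous[OF g(1)] by simp
  define Q where "Q s = max (- B) (min B (g (max 0 (min 1 s))))" for s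
  have "continuous_on UNIV Q"
    unfolding Q_def by (intro continuous_intros continuous_on_compose2[OF g_cont]) auto
  moreover have "\<bar>Q s\<bar> \<le> B" for s
    using \<open>0 \<le> B\<close> by (auto simp: Q_def)
  moreover have "Q s = h s" if "0 < s" "s < 1" for s
    using bound[OF that] g(2)[of s] that by (auto simp: Q_def)
  ultimately show ?thesis by blast
qed

lemma rescaled_potentials:
  fixes q :: "real \<Rightarrow> real" and v :: "int \<Rightarrow> 'k::real_normed_field"
  assumes p: "((\<lambda>x. of_real (q x)), v, X) \<in> PC m M" and m: "0 < m"
  obtains B Q where "\<And>n. continuous_on UNIV (Q n)" "\<And>n s. \<bar>Q n s\<bar> \<le> B"
    "\<And>n s. 0 < s \<Longrightarrow> s < 1 \<Longrightarrow> Q n s = q (X n + s * (X (n + 1) - X n))"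
proof -
  have X: "X \<in> point_sets m M"
    and q_bounded: "bounded ((\<lambda>x. of_real (q x) :: 'k) ` (- range X))"
    using p by (auto simp: PC_def)
  define gap where "gap = (\<lambda>n. X (n + 1) - X n)"
  have gap: "0 < gap n" for n
    using point_sets_gap[OF X, of n] m by (simp add: gap_def)
  have in_segment: "X n + s * gap n \<in> {X n<..<X (n + 1)}" if "0 < s" "s < 1" for n s
  proof -
    have "s * gap n < gap n" "0 < s * gap n" using that gap[of n] by simp_all
    moreover have "X n + gap n = X (n + 1)" by (simp add: gap_def)
    ultimately show ?thesis unfolding greaterThanLessThan_iff by linarith
  qed
  obtain B where B: "\<And>x. x \<notin> range X \<Longrightarrow> \<bar>q x\<bar> \<le> B"
    using q_bounded by (auto simp: bounded_iff)
  have B_segment: "\<bar>q (X n + s * gap n)\<bar> \<le> B" if "0 < s" "s < 1" for n s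
    by (rule B[OF point_sets_gap_free[OF X m in_segment[OF that]]])
  have "0 \<le> B"
    using B_segment[of "1/2" 0] by simp
  have "\<exists>Qn. continuous_on UNIV Qn \<and> (\<forall>s. \<bar>Qn s\<bar> \<le> B) \<and>
      (\<forall>s. 0 < s \<longrightarrow> s < 1 \<longrightarrow> Qn s = q (X n + s * gap n))" for n
  proof (rule continuous_extension_of_open_unit_interval[OF _ B_segment \<open>0 \<le> B\<close>])
    show "uniformly_continuous_on {0<..<1} (\<lambda>s. q (X n + s * gap n))"
      unfolding uniformly_continuous_on_def
    proof (intro allI impI)
      fix e :: real assume "0 < e"
      obtain \<delta> where "0 < \<delta>" and \<delta>: "\<And>n x y. x \<in> {X n<..<X (n + 1)} \<Longrightarrow>
          y \<in> {X n<..<X (n + 1)} \<Longrightarrow> \<bar>x - y\<bar> < \<delta> \<Longrightarrow> norm (of_real (q x) - of_real (q y) :: 'k) < e"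
        using modulus_on_segments[OF p m \<open>0 < e\<close>] by metis
      show "\<exists>\<delta>>0. \<forall>s\<in>{0<..<1}. \<forall>s'\<in>{0<..<1}. dist s' s < \<delta> \<longrightarrow>
          dist (q (X n + s' * gap n)) (q (X n + s * gap n)) < e"
      proof (intro exI[of _ "\<delta> / gap n"] conjI ballI impI)
        fix s s' :: real
        assume s: "s \<in> {0<..<1}" "s' \<in> {0<..<1}" "dist s' s < \<delta> / gap n"
        have "\<bar>X n + s' * gap n - (X n + s * gap n)\<bar> = \<bar>s' - s\<bar> * gap n"
          using gap[of n] by (simp add: abs_mult flip: left_diff_distrib)
        also have "\<dots> < \<delta>"
          using s(3) gap[of n] by (simp add: dist_real_def field_simps)
        finally have "norm (of_real (q (X n + s' * gap n)) - of_real (q (X n + s * gap n)) :: 'k) < e"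
          using \<delta>[of _ n] in_segment s(1,2) by simp
        thus "dist (q (X n + s' * gap n)) (q (X n + s * gap n)) < e"
          unfolding dist_real_def by (metis norm_of_real of_real_diff)
      qed (use \<open>0 < \<delta>\<close> gap[of n] in simp)
    qed
  qed
  then obtain Q where "\<And>n. continuous_on UNIV (Q n)" "\<And>n s. \<bar>Q n s\<bar> \<le> B"
    "\<And>n s. 0 < s \<Longrightarrow> s < 1 \<Longrightarrow> Q n s = q (X n + s * gap n)"
    by metis
  thus ?thesis
    by (intro that[of Q B]) (simp_all add: gap_def)
qed

text \<open>Total boundedness of the shifts, translated into the data of the single segments.\<close>

lemma segments_recurrent:
  fixes d :: "'k::real_normed_field triple \<Rightarrow> 'k triple \<Rightarrow> real"
  assumes m: "0 < m" and d: "PC_metric m M d" and ap: "(f, v, X) \<in> PC_ap m M d" and "0 < \<eta>"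
  defines "gap \<equiv> \<lambda>n. X (n + 1) - X n"
  shows "\<exists>T. finite T \<and> (\<forall>s::nat. \<exists>t\<in>T. \<forall>n.
    \<bar>gap (int (s + n)) - gap (int (t + n))\<bar> \<le> \<eta> \<and>
    norm (v (int (s + n)) - v (int (t + n))) \<le> \<eta> \<and>
    (\<forall>u\<in>{0<..<1}. norm (f (X (int (s + n)) + u * gap (int (s + n))) -
      f (X (int (t + n)) + u * gap (int (t + n)))) \<le> \<eta>))"
proof -
  have p: "(f, v, X) \<in> PC m M" using ap by (simp add: PC_ap_def)
  have "0 < \<eta> / 4" using \<open>0 < \<eta>\<close> by simp
  from modulus_on_segments[OF p m this] obtain \<delta> where "0 < \<delta>"
    and \<delta>: "\<And>n x y. x \<in> {X n<..<X (n + 1)} \<Longrightarrow> y \<in> {X n<..<X (n + 1)} \<Longrightarrow>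
      \<bar>x - y\<bar> < \<delta> \<Longrightarrow> norm (f x - f y) < \<eta> / 4" by metis
  \<comment> \<open>The resulting bounds are \<open>2 * r\<close>, \<open>r\<close> and \<open>2 * (\<eta> / 4) + r\<close>.\<close>
  define r where "r = min (\<eta> / 2) (min (m / 6) (\<delta> / 5))"
  have r: "0 < r" "r \<le> \<eta> / 2" "6 * r \<le> m" "4 * r < \<delta>"
    using \<open>0 < \<eta>\<close> m \<open>0 < \<delta>\<close> by (auto simp: r_def)
  obtain T where "finite T" and T: "\<And>s. \<exists>t\<in>T.
      (shift (f, v, X) (int s), shift (f, v, X) (int t)) \<in> entourage_S m M r"
    using shifts_totally_bounded[OF d ap r(1)] by metis
  have "\<exists>t\<in>T. \<forall>n. \<bar>gap (int (s + n)) - gap (int (t + n))\<bar> \<le> \<eta> \<and>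
      norm (v (int (s + n)) - v (int (t + n))) \<le> \<eta> \<and>
      (\<forall>u\<in>{0<..<1}. norm (f (X (int (s + n)) + u * gap (int (s + n))) -
        f (X (int (t + n)) + u * gap (int (t + n)))) \<le> \<eta>)" for s
  proof -
    obtain t where "t \<in> T" and t: "(shift (f, v, X) (int s), shift (f, v, X) (int t)) \<in> entourage_S m M r"
      using T by blast
    note close = segments_close[where \<epsilon> = "\<eta> / 4", OF p m t r(1,3,4)]
    have "\<bar>gap (int (s + n)) - gap (int (t + n))\<bar> \<le> \<eta>" for n
    proof -
      have "\<bar>gap (int (s + n)) - gap (int (t + n))\<bar> \<le> 2 * r"
        unfolding gap_def by (rule close(1)) (rule \<delta>)
      thus ?thesis using r(2) by simp
    qed
    moreover have "norm (v (int (s + n)) - v (int (t + n))) \<le> \<eta>" for n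
    proof -
      have "norm (v (int (s + n)) - v (int (t + n))) \<le> r"
        by (rule close(2)) (rule \<delta>)
      thus ?thesis using r(2) \<open>0 < \<eta>\<close> by linarith
    qed
    moreover have "norm (f (X (int (s + n)) + u * gap (int (s + n))) -
        f (X (int (t + n)) + u * gap (int (t + n)))) \<le> \<eta>" if "u \<in> {0<..<1}" for n u
    proof -
      have "norm (f (X (int (s + n)) + u * gap (int (s + n))) -
          f (X (int (t + n)) + u * gap (int (t + n)))) \<le> 2 * (\<eta> / 4) + r"
        unfolding gap_def by (rule close(3)) (rule \<delta>, use that in auto)
      thus ?thesis using r(2) by simp
    qed
    ultimately show ?thesis using \<open>t \<in> T\<close> by blast
  qed
  thus ?thesis using \<open>finite T\<close> by blast
qed

theorem theorem5p3:
  fixes m M E :: real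
    and d :: "'k::real_normed_field triple \<Rightarrow> 'k triple \<Rightarrow> real"
    and q :: "real \<Rightarrow> real" and V X :: "int \<Rightarrow> real"
  assumes "0 < m" and "m \<le> M"
    and "PC_metric m M d"
    and "((\<lambda>x. of_real (q x)), (\<lambda>i. of_real (V i)), X) \<in> PC_ap m M d"
  shows "\<exists>!\<rho>. \<forall>\<Xi>.
    ((\<lambda>n. (prufer_angle E (q, V, X) \<Xi> (X n) - \<Xi>) / X n) \<longlongrightarrow> \<rho>) at_top \<and>
    ((\<lambda>x. (prufer_angle E (q, V, X) \<Xi> x - \<Xi>) / x) \<longlongrightarrow> \<rho>) at_top"
proof -
  have p: "((\<lambda>x. of_real (q x) :: 'k), (\<lambda>i. of_real (V i)), X) \<in> PC m M"
    using assms(4) by (simp add: PC_ap_def)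
  hence X: "X \<in> point_sets m M" and V_bounded: "bounded (range (\<lambda>i. of_real (V i) :: 'k))"
    by (auto simp: PC_def)
  obtain W where W: "\<And>i. \<bar>V i\<bar> \<le> W"
    using V_bounded by (auto simp: bounded_iff)
  obtain B Q where Q: "\<And>n. continuous_on UNIV (Q n)" "\<And>n s. \<bar>Q n s\<bar> \<le> B"
    "\<And>n s. 0 < s \<Longrightarrow> s < 1 \<Longrightarrow> Q n s = q (X n + s * (X (n + 1) - X n))"
    by (rule rescaled_potentials[OF p \<open>0 < m\<close>]) (rule that)
  interpret data: prufer_data m M B W E q Q V X
    by unfold_locales (use \<open>0 < m\<close> X Q W in auto)
  have norm_diff: "norm (of_real a - of_real b :: 'k) = \<bar>a - b\<bar>" for a b
    by (metis norm_of_real of_real_diff)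
  interpret almost_periodic_prufer_data m M B W E q Q V X
  proof
    fix \<eta> :: real assume "0 < \<eta>"
    from segments_recurrent[OF \<open>0 < m\<close> assms(3,4) this] show "\<exists>T. finite T \<and> (\<forall>s::nat. \<exists>t\<in>T. \<forall>n.
        \<bar>data.gap (int (s + n)) - data.gap (int (t + n))\<bar> \<le> \<eta> \<and>
        \<bar>V (int (s + n)) - V (int (t + n))\<bar> \<le> \<eta> \<and>
        (\<forall>u\<in>{0<..<1}. \<bar>Q (int (s + n)) u - Q (int (t + n)) u\<bar> \<le> \<eta>))"
      unfolding norm_diff by (simp add: Q(3) data.gap_def)
  qed
  obtain \<rho> where \<rho>: "\<forall>\<Xi>.
    ((\<lambda>n. (prufer_angle E (q, V, X) \<Xi> (X n) - \<Xi>) / X n) \<longlongrightarrow> \<rho>) at_top \<and>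
    ((\<lambda>x. (prufer_angle E (q, V, X) \<Xi> x - \<Xi>) / x) \<longlongrightarrow> \<rho>) at_top"
    using rotation_number by blast
  show ?thesis
  proof (rule ex1I[where a = \<rho>])
    show "\<forall>\<Xi>.
      ((\<lambda>n. (prufer_angle E (q, V, X) \<Xi> (X n) - \<Xi>) / X n) \<longlongrightarrow> \<rho>) at_top \<and>
      ((\<lambda>x. (prufer_angle E (q, V, X) \<Xi> x - \<Xi>) / x) \<longlongrightarrow> \<rho>) at_top"
      by (rule \<rho>)
    fix \<rho>'
    assume \<rho>': "\<forall>\<Xi>.
      ((\<lambda>n. (prufer_angle E (q, V, X) \<Xi> (X n) - \<Xi>) / X n) \<longlongrightarrow> \<rho>') at_top \<and>
      ((\<lambda>x. (prufer_angle E (q, V, X) \<Xi> x - \<Xi>) / x) \<longlongrightarrow> \<rho>') at_top"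
    have "((\<lambda>x. (prufer_angle E (q, V, X) 0 x - 0) / x) \<longlongrightarrow> \<rho>') at_top"
      using \<rho>' by blast
    moreover have "((\<lambda>x. (prufer_angle E (q, V, X) 0 x - 0) / x) \<longlongrightarrow> \<rho>) at_top"
      using \<rho> by blast
    ultimately show "\<rho>' = \<rho>"
      by (rule tendsto_unique[OF trivial_limit_at_top_linorder])
  qed
qed

end
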